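(* Let $T\subset\mathbb{R}^2$ be a compact convex set containing the origin in its interior. (a) Let $\varepsilon>0$ and let $T_\varepsilon$ be a convex polygon (compact, with non-empty interior) such that $T_\varepsilon\subset T\subset(1+\varepsilon)\,T_\varepsilon$. Then $\ell(T_\varepsilon)\le\ell(T)\le(1+\varepsilon)\,\ell(T_\varepsilon)$. (b) Let $\varepsilon_n>0$ with $\varepsilon_n\to0$, let $T_{\varepsilon_n}$ be convex polygons (compact, with non-empty interior) such that $T_{\varepsilon_n}\subset T\subset(1+\varepsilon_n)\,T_{\varepsilon_n}$ for all $n$, and for each $n$ choose $c_n\in\mathcal{P}_{\min}(T_{\varepsilon_n})$. Then a subsequence of $(c_n)$ converges to an orbit $c\in\mathcal{P}_{\min}(T)$. (c) Every $c\in\mathcal{P}_{\min}(T)$ can be obtained as such a limit for some choice of $\varepsilon_n$, $T_{\varepsilon_n}$ and $c_n$ as in (b).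
   Context: A planar convex billiard table is a compact convex set $T\subset\mathbb{R}^2$ with non-empty interior. An outward support vector of $T$ at $q\in\partial T$ is a vector $\nu$ with $\langle x-q,\nu\rangle\le0$ for all $x\in T$. A generalised billiard orbit on $T$ is a sequence $q_i\in\partial T$, $i\in\mathbb{Z}$ (consecutive points distinct), such that for every $i$ the vector $\frac{q_i-q_{i-1}}{\|q_i-q_{i-1}\|}+\frac{q_i-q_{i+1}}{\|q_i-q_{i+1}\|}$ is an outward support vector of $T$ at $q_i$. It is closed if $q_{i+n}=q_i$ for all $i$ for some $n\ge2$; for the smallest such $n$ its length is $\ell(c)=\sum_{i=0}^{n-1}\|q_{i+1}-q_i\|$. Closed orbits with the same trace (the closed polygonal curve, as a subset of $\mathbb{R}^2$) are identified, and convergence of orbits means convergence of their traces in the Hausdorff metric. $\ell(T)$ is the minimum of $\ell(c)$ over all generalised closed billiard orbits $c$ on $T$, and $\mathcal{P}_{\min}(T)$ is the set of generalised closed billiard orbits of length $\ell(T)$. For $r>0$, $rT=\{rx : x\in T\}$. *)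

theory Defs
  imports "HOL-Analysis.Analysis"
begin

type_synonym plane = "real ^ 2"

text \<open>The zero vector is admitted: an orbit may pass straight through a boundary point.\<close>

definition outward_support_vector :: "plane set \<Rightarrow> plane \<Rightarrow> plane \<Rightarrow> bool" where
  "outward_support_vector T q \<nu> \<longleftrightarrow> q \<in> frontier T \<and> (\<forall>x\<in>T. (x - q) \<bullet> \<nu> \<le> 0)"

definition generalised_billiard_orbit :: "plane set \<Rightarrow> (int \<Rightarrow> plane) \<Rightarrow> bool" where
  "generalised_billiard_orbit T q \<longleftrightarrow>
     (\<forall>i. q i \<in> frontier T \<and> q (i + 1) \<noteq> q i \<and>
        outward_support_vector T (q i)
          ((1 / norm (q i - q (i - 1))) *\<^sub>R (q i - q (i - 1)) +
           (1 / norm (q i - q (i + 1))) *\<^sub>R (q i - q (i + 1))))"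

definition has_period :: "(int \<Rightarrow> plane) \<Rightarrow> nat \<Rightarrow> bool" where
  "has_period q n \<longleftrightarrow> n \<ge> 2 \<and> (\<forall>i. q (i + int n) = q i)"

definition generalised_closed_orbit :: "plane set \<Rightarrow> (int \<Rightarrow> plane) \<Rightarrow> bool" where
  "generalised_closed_orbit T q \<longleftrightarrow> generalised_billiard_orbit T q \<and> (\<exists>n. has_period q n)"

definition minimal_period :: "(int \<Rightarrow> plane) \<Rightarrow> nat" where
  "minimal_period q = (LEAST n. has_period q n)"

definition orbit_length :: "(int \<Rightarrow> plane) \<Rightarrow> real" where
  "orbit_length q = (\<Sum>i<minimal_period q. norm (q (int i + 1) - q (int i)))"

definition orbit_trace :: "(int \<Rightarrow> plane) \<Rightarrow> plane set" where
  "orbit_trace q = (\<Union>i. closed_segment (q i) (q (i + 1)))"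

definition min_orbit_length :: "plane set \<Rightarrow> real" where
  "min_orbit_length T = (LEAST l. \<exists>q. generalised_closed_orbit T q \<and> l = orbit_length q)"

text \<open>Orbits with the same trace are to be identified. The set below consists of all
  representing sequences; the identification is accounted for by comparing orbits only
  through their traces, as in \<open>orbits_converge\<close>.\<close>

definition minimal_orbits :: "plane set \<Rightarrow> (int \<Rightarrow> plane) set" where
  "minimal_orbits T = {q. generalised_closed_orbit T q \<and> orbit_length q = min_orbit_length T}"

text \<open>This is the Hausdorff metric on non-empty compact sets; traces of closed orbits are such.\<close>

definition hausdorff_distance :: "plane set \<Rightarrow> plane set \<Rightarrow> real" where
  "hausdorff_distance A B = max (SUP a\<in>A. infdist a B) (SUP b\<in>B. infdist b A)"

definition orbits_converge :: "(nat \<Rightarrow> int \<Rightarrow> plane) \<Rightarrow> (int \<Rightarrow> plane) \<Rightarrow> bool" where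
  "orbits_converge c q \<longleftrightarrow>
     (\<lambda>n. hausdorff_distance (orbit_trace (c n)) (orbit_trace q)) \<longlonglongrightarrow> 0"

definition convex_polygon :: "plane set \<Rightarrow> bool" where
  "convex_polygon P \<longleftrightarrow> polytope P \<and> interior P \<noteq> {}"

definition polygonal_approximation :: "plane set \<Rightarrow> real \<Rightarrow> plane set \<Rightarrow> bool" where
  "polygonal_approximation T \<epsilon> P \<longleftrightarrow>
     \<epsilon> > 0 \<and> convex_polygon P \<and> P \<subseteq> T \<and> T \<subseteq> (\<lambda>x. (1 + \<epsilon>) *\<^sub>R x) ` P"

definition approximating_orbits ::
  "plane set \<Rightarrow> (nat \<Rightarrow> real) \<Rightarrow> (nat \<Rightarrow> plane set) \<Rightarrow> (nat \<Rightarrow> int \<Rightarrow> plane) \<Rightarrow> bool" where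
  "approximating_orbits T \<epsilon> P c \<longleftrightarrow>
     \<epsilon> \<longlonglongrightarrow> 0 \<and> (\<forall>n. polygonal_approximation T (\<epsilon> n) (P n)) \<and>
     (\<forall>n. c n \<in> minimal_orbits (P n))"

end

theory Submission
  imports Defs
begin

text \<open>
  Billiard reflection is awkward to carry to a limit, and polygons approximating \<open>T\<close> have
  normals that need not resemble those of \<open>T\<close>. Both difficulties disappear when minimal orbits
  are characterised without reference to reflection, following an idea of Bezdek and Bezdek:
  up to their parametrisation, the shortest closed billiard orbits of a planar convex body \<open>T\<close>
  are exactly the triangles, possibly degenerate, of least perimeter among those that cannot be
  translated into the interior of \<open>T\<close>, placed inside \<open>T\<close>.

  One direction is combinatorial. The support vectors along a closed orbit are differences of
  consecutive unit directions, so they sum to zero over a period, and this obstructs every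
  translation of the vertices into the interior. By Helly's theorem three of the vertices already
  cannot be translated there, and by the triangle inequality the triangle they span is no longer
  than the orbit. If it is equally long, the orbit runs along its sides
  (\<open>billiard_orbit_triangle\<close>). The other direction is Lagrange duality. The impossibility of a
  translation is certified by three normals with sum zero
  (\<open>untranslatable_obtain_normals\<close>, by separation in the threefold product of the plane), and
  for a triangle of least perimeter these normals are, up to one common positive factor, the
  partial gradients of the perimeter, which says that the billiard law holds at the
  vertices (\<open>shortest_triangle_realised\<close>).

  Untranslatability passes to smaller bodies, scales, and is a closed condition. Part (a) is then
  a comparison of perimeters, and part (b) is compactness of the set of triples of points of \<open>T\<close>.
  For part (c), the three half planes given by the normals of a shortest triangle of \<open>T\<close> are used
  to cut a polygon lying tightly around \<open>T\<close>. The same triangle remains a shortest one for this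
  polygon, and shrinking the polygon slightly puts it inside \<open>T\<close>, together with a scaled copy of
  the given orbit.
\<close>

section \<open>Triangles that cannot be translated into the interior\<close>

definition untranslatable :: "plane set \<Rightarrow> plane \<Rightarrow> plane \<Rightarrow> plane \<Rightarrow> bool" where
  "untranslatable T a b c \<longleftrightarrow>
     (\<nexists>t. a + t \<in> interior T \<and> b + t \<in> interior T \<and> c + t \<in> interior T)"

definition perimeter :: "plane \<Rightarrow> plane \<Rightarrow> plane \<Rightarrow> real" where
  "perimeter a b c = dist a b + dist b c + dist c a"

definition sides :: "plane \<Rightarrow> plane \<Rightarrow> plane \<Rightarrow> plane set" where
  "sides a b c = closed_segment a b \<union> closed_segment b c \<union> closed_segment c a"

text \<open>Membership of the vertices in \<open>T\<close> fixes the position of the triangle; the competitors range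
  over the whole plane, so that minimality can be tested on triangles obtained by scaling.\<close>

definition shortest_triangle :: "plane set \<Rightarrow> plane \<Rightarrow> plane \<Rightarrow> plane \<Rightarrow> bool" where
  "shortest_triangle T a b c \<longleftrightarrow>
     a \<in> T \<and> b \<in> T \<and> c \<in> T \<and> untranslatable T a b c \<and>
     (\<forall>x y z. untranslatable T x y z \<longrightarrow> perimeter a b c \<le> perimeter x y z)"

definition convex_body :: "plane set \<Rightarrow> bool" where
  "convex_body T \<longleftrightarrow> compact T \<and> convex T \<and> interior T \<noteq> {}"

lemma untranslatable_swap:
  "untranslatable T a b c \<Longrightarrow> untranslatable T b a c"
  "untranslatable T a b c \<Longrightarrow> untranslatable T a c b"
  unfolding untranslatable_def by blast+

lemma perimeter_swap:
  "perimeter b a c = perimeter a b c"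
  "perimeter a c b = perimeter a b c"
  unfolding perimeter_def by (simp_all add: dist_commute)

lemma sides_swap:
  "sides b a c = sides a b c"
  "sides a c b = sides a b c"
  unfolding sides_def by (auto simp: closed_segment_commute)

lemma shortest_triangle_swap:
  "shortest_triangle T a b c \<Longrightarrow> shortest_triangle T b a c"
  "shortest_triangle T a b c \<Longrightarrow> shortest_triangle T a c b"
  unfolding shortest_triangle_def by (auto simp: perimeter_swap dest: untranslatable_swap)

lemma perimeter_nonneg: "0 \<le> perimeter a b c"
  unfolding perimeter_def by simp

lemma perimeter_scaleR:
  assumes "0 \<le> r"
  shows "perimeter (r *\<^sub>R a) (r *\<^sub>R b) (r *\<^sub>R c) = r * perimeter a b c"
proof -
  have "dist (r *\<^sub>R x) (r *\<^sub>R y) = r * dist x y" for x y :: plane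
    using assms by (simp add: dist_norm flip: scaleR_diff_right)
  then show ?thesis unfolding perimeter_def by (simp add: distrib_left)
qed

lemma interior_scaleR:
  fixes S :: "'a::euclidean_space set"
  assumes "r \<noteq> 0"
  shows "interior ((*\<^sub>R) r ` S) = (*\<^sub>R) r ` interior S"
  by (rule interior_injective_linear_image) (use assms in \<open>auto simp: inj_on_def\<close>)

text \<open>A translation of the scaled triangle into \<open>T\<close> would
  scale back to a translation of the original one into \<open>P\<close>. The case \<open>r = 1\<close> compares nested
  bodies.\<close>

lemma untranslatable_scaleR:
  assumes nt: "untranslatable P a b c" and r: "r > 0" and sub: "T \<subseteq> (*\<^sub>R) r ` P"
  shows "untranslatable T (r *\<^sub>R a) (r *\<^sub>R b) (r *\<^sub>R c)"
  unfolding untranslatable_def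
proof
  assume "\<exists>t. r *\<^sub>R a + t \<in> interior T \<and> r *\<^sub>R b + t \<in> interior T \<and> r *\<^sub>R c + t \<in> interior T"
  then obtain t where t: "r *\<^sub>R a + t \<in> interior T" "r *\<^sub>R b + t \<in> interior T"
    "r *\<^sub>R c + t \<in> interior T" by blast
  have int: "interior T \<subseteq> (*\<^sub>R) r ` interior P"
    using interior_mono[OF sub] r by (simp add: interior_scaleR)
  have pull: "x + (1 / r) *\<^sub>R t \<in> interior P" if x: "r *\<^sub>R x + t \<in> interior T" for x
  proof -
    obtain y where "y \<in> interior P" "r *\<^sub>R x + t = r *\<^sub>R y" using int x by blast
    then have "y = (1 / r) *\<^sub>R (r *\<^sub>R x + t)" using r by simp
    then have "y = x + (1 / r) *\<^sub>R t" using r by (simp add: scaleR_add_right)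
    with \<open>y \<in> interior P\<close> show ?thesis by simp
  qed
  show False using nt pull[OF t(1)] pull[OF t(2)] pull[OF t(3)] unfolding untranslatable_def by blast
qed

lemma untranslatable_antimono:
  "untranslatable T a b c \<Longrightarrow> P \<subseteq> T \<Longrightarrow> untranslatable P a b c"
  using untranslatable_scaleR[of T a b c 1 P] by simp

section \<open>Certificates by normals\<close>

lemma support_less_interior:
  fixes u :: "'a::euclidean_space"
  assumes "x \<in> interior T" "u \<noteq> 0" "\<forall>y\<in>T. u \<bullet> y \<le> \<alpha>"
  shows "u \<bullet> x < \<alpha>"
proof -
  obtain e where e: "e > 0" "cball x e \<subseteq> T"
    using assms(1) mem_interior_cball by blast
  have "x + (e / norm u) *\<^sub>R u \<in> cball x e"
    using e assms(2) by (simp add: dist_norm)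
  then have "u \<bullet> (x + (e / norm u) *\<^sub>R u) \<le> \<alpha>" using e assms(3) by blast
  moreover have "u \<bullet> ((e / norm u) *\<^sub>R u) > 0"
    using e assms(2) by simp
  ultimately show ?thesis by (simp add: inner_add_right)
qed

lemma support_point_in_frontier:
  assumes "a \<in> T" "u \<noteq> (0::'a::euclidean_space)" "\<forall>x\<in>T. u \<bullet> x \<le> u \<bullet> a"
  shows "a \<in> frontier T"
  using support_less_interior[of a T u "u \<bullet> a"] assms closure_subset[of T]
  unfolding frontier_def by auto

lemma outward_support_vector_scaleR:
  assumes "a \<in> T" "u \<noteq> 0" "\<forall>x\<in>T. u \<bullet> x \<le> u \<bullet> a" "r > 0"
  shows "outward_support_vector T a (r *\<^sub>R u)"
  unfolding outward_support_vector_def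
proof (intro conjI ballI)
  show "a \<in> frontier T" by (rule support_point_in_frontier[OF assms(1-3)])
  fix x assume "x \<in> T"
  then have "u \<bullet> (x - a) \<le> 0" using assms(3) by (simp add: inner_diff_right)
  then have "r * (u \<bullet> (x - a)) \<le> 0" using assms(4) by (simp add: mult_nonneg_nonpos)
  then show "(x - a) \<bullet> (r *\<^sub>R u) \<le> 0" by (simp add: inner_commute)
qed

text \<open>As the normals sum to zero, the value of \<open>u \<bullet> x + v \<bullet> y + w \<bullet> z\<close> is invariant under
  translations, while on the interior it stays strictly below the sum of the support values.\<close>

lemma untranslatable_by_normals:
  assumes sum0: "u + v + w = 0" and nz: "u \<noteq> 0 \<or> v \<noteq> 0 \<or> w \<noteq> 0"
    and sup: "\<forall>x\<in>T. u \<bullet> x \<le> \<alpha>" "\<forall>x\<in>T. v \<bullet> x \<le> \<beta>" "\<forall>x\<in>T. w \<bullet> x \<le> \<gamma>"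
    and ge: "\<alpha> + \<beta> + \<gamma> \<le> u \<bullet> x + v \<bullet> y + w \<bullet> z"
  shows "untranslatable T x y z"
  unfolding untranslatable_def
proof
  assume "\<exists>t. x + t \<in> interior T \<and> y + t \<in> interior T \<and> z + t \<in> interior T"
  then obtain t where t: "x + t \<in> interior T" "y + t \<in> interior T" "z + t \<in> interior T" by blast
  have le: "u \<bullet> (x + t) \<le> \<alpha>" "v \<bullet> (y + t) \<le> \<beta>" "w \<bullet> (z + t) \<le> \<gamma>"
    using sup t interior_subset by blast+
  have "u \<bullet> (x + t) + v \<bullet> (y + t) + w \<bullet> (z + t) < \<alpha> + \<beta> + \<gamma>"
    using nz le support_less_interior[OF t(1) _ sup(1)] support_less_interior[OF t(2) _ sup(2)]
      support_less_interior[OF t(3) _ sup(3)] by linarith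
  moreover have "u \<bullet> (x + t) + v \<bullet> (y + t) + w \<bullet> (z + t)
      = u \<bullet> x + v \<bullet> y + w \<bullet> z + (u + v + w) \<bullet> t"
    by (simp add: algebra_simps)
  ultimately show False using sum0 ge by simp
qed

text \<open>Converse of the previous lemma: the translates of the triangle form an affine plane in the
  threefold product, and this plane misses the open convex set of triples of interior points. A
  separating functional has to vanish in the diagonal direction, which means that its components
  sum to zero.\<close>

lemma untranslatable_obtain_normals:
  assumes T: "convex T" "interior T \<noteq> {}" and abc: "a \<in> T" "b \<in> T" "c \<in> T"
    and nt: "untranslatable T a b c"
  obtains u v w where "u + v + w = 0" "u \<noteq> 0 \<or> v \<noteq> 0 \<or> w \<noteq> 0"
    "\<forall>x\<in>T. u \<bullet> x \<le> u \<bullet> a" "\<forall>x\<in>T. v \<bullet> x \<le> v \<bullet> b" "\<forall>x\<in>T. w \<bullet> x \<le> w \<bullet> c"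
proof -
  let ?K = "interior T \<times> interior T \<times> interior T"
  let ?D = "range (\<lambda>t. (a + t, b + t, c + t))"
  have D: "convex ?D"
  proof -
    have "?D = (\<lambda>x. (a, b, c) + x) ` range (\<lambda>t. (t, t, t))"
      by (auto simp: image_iff)
    moreover have "convex (range (\<lambda>t::plane. (t, t, t)))"
      by (rule convex_linear_image) (auto intro!: linearI)
    ultimately show ?thesis by (simp only: convex_translation)
  qed
  have K: "convex ?K" using T by (intro convex_Times convex_interior)
  have disj: "?K \<inter> ?D = {}" using nt unfolding untranslatable_def by blast
  have "?K \<noteq> {}" using T by auto
  from separating_hyperplane_sets[OF K D this _ disj]
  obtain n \<beta> where n: "n \<noteq> 0" and lo: "\<forall>x\<in>?K. n \<bullet> x \<le> \<beta>" and hi: "\<forall>x\<in>?D. n \<bullet> x \<ge> \<beta>"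
    by blast
  obtain u v w where uvw: "n = (u, v, w)" by (metis prod.exhaust)
  let ?N = "u + v + w"
  let ?s = "u \<bullet> a + v \<bullet> b + w \<bullet> c"
  have hi': "\<beta> \<le> ?s + ?N \<bullet> t" for t
  proof -
    have "\<beta> \<le> n \<bullet> (a + t, b + t, c + t)" using hi by blast
    then show ?thesis by (simp add: uvw inner_prod_def algebra_simps)
  qed
  \<comment> \<open>A nonzero sum would make the bound \<open>hi'\<close> fail for a suitable multiple of it.\<close>
  have N0: "?N = 0"
  proof (rule ccontr)
    assume "?N \<noteq> 0"
    then have pos: "?N \<bullet> ?N > 0" by simp
    define r where "r = (\<beta> - ?s - 1) / (?N \<bullet> ?N)"
    have "\<beta> \<le> ?s + r * (?N \<bullet> ?N)"
      using hi'[of "r *\<^sub>R ?N"] by (simp only: inner_scaleR_right)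
    also have "r * (?N \<bullet> ?N) = \<beta> - ?s - 1"
      unfolding r_def using pos by (intro nonzero_eq_divide_eq[THEN iffD1]) (auto simp only: less_irrefl)
    finally show False by simp
  qed
  have cl: "n \<bullet> p \<le> ?s" if "p \<in> T \<times> T \<times> T" for p
  proof -
    have "closure ?K = closure T \<times> closure T \<times> closure T"
      using T by (simp add: closure_Times convex_closure_interior)
    then have "p \<in> closure ?K" using that subsetD[OF closure_subset[of T]] by auto
    moreover have "closure ?K \<subseteq> {p. n \<bullet> p \<le> \<beta>}"
      by (rule closure_minimal) (use lo in \<open>auto simp: closed_halfspace_le\<close>)
    ultimately show ?thesis using hi'[of 0] by auto
  qed
  show ?thesis
  proof (rule that)
    show "u + v + w = 0" by (rule N0)
    show "u \<noteq> 0 \<or> v \<noteq> 0 \<or> w \<noteq> 0" using n uvw by (auto simp: zero_prod_def)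
    show "\<forall>x\<in>T. u \<bullet> x \<le> u \<bullet> a"
    proof
      fix x assume "x \<in> T"
      then show "u \<bullet> x \<le> u \<bullet> a" using cl[of "(x, b, c)"] abc by (simp add: uvw)
    qed
    show "\<forall>x\<in>T. v \<bullet> x \<le> v \<bullet> b"
    proof
      fix x assume "x \<in> T"
      then show "v \<bullet> x \<le> v \<bullet> b" using cl[of "(a, x, c)"] abc by (simp add: uvw)
    qed
    show "\<forall>x\<in>T. w \<bullet> x \<le> w \<bullet> c"
    proof
      fix x assume "x \<in> T"
      then show "w \<bullet> x \<le> w \<bullet> c" using cl[of "(a, b, x)"] abc by (simp add: uvw)
    qed
  qed
qed

section \<open>From closed orbits to triangles\<close>

lemma path_length_ge_dist:
  fixes f :: "nat \<Rightarrow> 'a::metric_space"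
  assumes "i \<le> j"
  shows "dist (f i) (f j) \<le> (\<Sum>m\<in>{i..<j}. dist (f m) (f (Suc m)))"
  using assms
proof (induction rule: dec_induct)
  case (step n)
  then show ?case using dist_triangle[of "f i" "f (Suc n)" "f n"] by simp
qed simp

text \<open>The starting point is inserted to cover the empty path \<open>i = j\<close>.\<close>

lemma path_straight:
  fixes f :: "nat \<Rightarrow> 'a::euclidean_space"
  assumes "i \<le> j"
    and "(\<Sum>m\<in>{i..<j}. dist (f m) (f (Suc m))) = dist (f i) (f j)"
  shows "insert (f i) (\<Union>m\<in>{i..<j}. closed_segment (f m) (f (Suc m))) = closed_segment (f i) (f j)"
  using assms
proof (induction rule: dec_induct)
  case (step n)
  let ?L = "\<Sum>m\<in>{i..<n}. dist (f m) (f (Suc m))"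
  have "?L + dist (f n) (f (Suc n)) = dist (f i) (f (Suc n))"
    using step by simp
  moreover have "dist (f i) (f n) \<le> ?L" using step by (intro path_length_ge_dist) simp
  moreover have "dist (f i) (f (Suc n)) \<le> dist (f i) (f n) + dist (f n) (f (Suc n))"
    by (rule dist_triangle)
  ultimately have L: "?L = dist (f i) (f n)"
    and tri: "dist (f i) (f (Suc n)) = dist (f i) (f n) + dist (f n) (f (Suc n))" by linarith+
  have "f n \<in> closed_segment (f i) (f (Suc n))"
    using tri by (simp add: between_mem_segment[symmetric] between)
  then have "closed_segment (f i) (f n) \<union> closed_segment (f n) (f (Suc n)) = closed_segment (f i) (f (Suc n))"
    by (rule Un_closed_segment)
  then show ?case using step.IH[OF L] step.hyps by (auto simp: atLeastLessThanSuc)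
qed simp


lemma has_period_minimal_period:
  assumes "has_period q n"
  shows "has_period q (minimal_period q)"
  using assms unfolding minimal_period_def by (rule LeastI)

lemma has_period_mult:
  assumes "has_period q p"
  shows "q (z + int p * k) = q z"
proof (induction k rule: int_induct[where k = 0])
  case (step1 k)
  have "q (z + int p * (k + 1)) = q ((z + int p * k) + int p)"
    by (simp add: algebra_simps)
  then show ?case using step1 assms unfolding has_period_def by simp
next
  case (step2 k)
  have "q ((z + int p * (k - 1)) + int p) = q (z + int p * (k - 1))"
    using assms unfolding has_period_def by blast
  moreover have "(z + int p * (k - 1)) + int p = z + int p * k"
    by (simp add: algebra_simps)
  ultimately show ?case using step2 by simp
qed simp

lemma orbit_trace_one_period:
  assumes "has_period q p"
  shows "orbit_trace q = (\<Union>m\<in>{i..<i + p}. closed_segment (q (int m)) (q (int (Suc m))))"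
proof
  show "(\<Union>m\<in>{i..<i + p}. closed_segment (q (int m)) (q (int (Suc m)))) \<subseteq> orbit_trace q"
    unfolding orbit_trace_def by (force simp: add.commute)
  show "orbit_trace q \<subseteq> (\<Union>m\<in>{i..<i + p}. closed_segment (q (int m)) (q (int (Suc m))))"
    unfolding orbit_trace_def
  proof (rule UN_least)
    fix z :: int
    have p: "p > 0" using assms unfolding has_period_def by simp
    define m where "m = i + nat ((z - int i) mod int p)"
    have m: "int m = int i + (z - int i) mod int p"
      unfolding m_def using p by simp
    have "0 \<le> (z - int i) mod int p" "(z - int i) mod int p < int p" using p by simp_all
    then have mem: "m \<in> {i..<i + p}" using m by auto
    have z: "z = int m + int p * ((z - int i) div int p)"
      unfolding m by (simp add: algebra_simps)
    have z1: "z + 1 = int (Suc m) + int p * ((z - int i) div int p)"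
      using z by simp
    have "q z = q (int m)" "q (z + 1) = q (int (Suc m))"
      by (subst z z1, rule has_period_mult[OF assms])+
    then show "closed_segment (q z) (q (z + 1)) \<subseteq>
        (\<Union>m\<in>{i..<i + p}. closed_segment (q (int m)) (q (int (Suc m))))"
      using mem by auto
  qed
qed

lemma sum_one_period:
  fixes g :: "nat \<Rightarrow> real"
  assumes "\<And>m. g (m + p) = g m" "i \<le> p"
  shows "(\<Sum>m\<in>{i..<i + p}. g m) = (\<Sum>m<p. g m)"
proof -
  have "(\<Sum>m\<in>{i..<i + p}. g m) = (\<Sum>m\<in>{i..<p}. g m) + (\<Sum>m\<in>{p..<p + i}. g m)"
    using assms(2) by (subst sum.atLeastLessThan_concat) (auto simp: add.commute)
  also have "(\<Sum>m\<in>{p..<p + i}. g m) = (\<Sum>m\<in>{0..<i}. g m)"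
    using sum.shift_bounds_nat_ivl[of g 0 p i] assms(1) by (simp add: add.commute)
  also have "(\<Sum>m\<in>{i..<p}. g m) + (\<Sum>m\<in>{0..<i}. g m) = (\<Sum>m\<in>{0..<p}. g m)"
    using assms(2) by (simp add: sum.atLeastLessThan_concat add.commute)
  finally show ?thesis by (simp add: lessThan_atLeast0)
qed

text \<open>If \<open>t\<close> moved every vertex into the interior, then the inner product of \<open>t\<close> with every nonzero
  support vector would be negative. The support vectors are differences of consecutive unit
  directions \<open>U m\<close> and telescope to zero over a period, so all of them vanish. Hence the
  direction is constant, and such a path never returns to its start.\<close>

lemma billiard_orbit_untranslatable:
  assumes orb: "generalised_billiard_orbit T q" and per: "has_period q p"
  shows "\<nexists>t. \<forall>m<p. q (int m) + t \<in> interior T"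
proof
  assume "\<exists>t. \<forall>m<p. q (int m) + t \<in> interior T"
  then obtain t where t: "\<And>m. m < p \<Longrightarrow> q (int m) + t \<in> interior T" by blast
  have p: "p \<ge> 2" and qp: "\<And>i. q (i + int p) = q i" using per unfolding has_period_def by auto
  define f where "f m = q (int m)" for m
  define l where "l m = norm (f (Suc m) - f m)" for m
  define U where "U m = (1 / l m) *\<^sub>R (f (Suc m) - f m)" for m
  have fp: "f p = f 0" "f (Suc p) = f (Suc 0)"
    using qp[of 0] qp[of 1] by (auto simp: f_def add.commute)
  have ne: "f (Suc m) \<noteq> f m" for m
    using orb unfolding generalised_billiard_orbit_def f_def by (metis add.commute of_nat_Suc)
  have lpos: "l m > 0" for m using ne unfolding l_def by simp
  have lU: "f (Suc m) - f m = l m *\<^sub>R U m" for m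
    using lpos[of m] unfolding U_def by simp
  have sup: "(x - f (Suc m)) \<bullet> (U m - U (Suc m)) \<le> 0" if x: "x \<in> T" for x m
  proof -
    have "U m - U (Suc m) =
          (1 / norm (q (1 + int m) - q (1 + int m - 1))) *\<^sub>R (q (1 + int m) - q (1 + int m - 1)) +
          (1 / norm (q (1 + int m) - q (1 + int m + 1))) *\<^sub>R (q (1 + int m) - q (1 + int m + 1))"
      unfolding U_def l_def f_def
      by (simp add: add.commute norm_minus_commute flip: scaleR_minus_right)
    then show ?thesis
      using orb x unfolding generalised_billiard_orbit_def outward_support_vector_def f_def
      by (metis of_nat_Suc)
  qed
  have strict: "t \<bullet> (U m - U (Suc m)) < 0" if "m < p" "U m \<noteq> U (Suc m)" for m
  proof -
    have "f (Suc m) + t \<in> interior T"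
      using t[of "Suc m"] t[of 0] fp that p unfolding f_def by (cases "Suc m = p") auto
    moreover have "\<forall>y\<in>T. (U m - U (Suc m)) \<bullet> y \<le> (U m - U (Suc m)) \<bullet> f (Suc m)"
      using sup[of _ m] by (auto simp: inner_diff_left inner_commute)
    ultimately have "(U m - U (Suc m)) \<bullet> (f (Suc m) + t) < (U m - U (Suc m)) \<bullet> f (Suc m)"
      using that by (intro support_less_interior) auto
    then show ?thesis by (simp only: inner_add_right inner_commute[of t])
  qed
  have "(\<Sum>m<p. - (t \<bullet> (U m - U (Suc m)))) = - (t \<bullet> (\<Sum>m<p. U m - U (Suc m)))"
    by (simp add: inner_sum_right sum_negf)
  also have "(\<Sum>m<p. U m - U (Suc m)) = U 0 - U p" by (rule sum_lessThan_telescope')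
  also have "U p = U 0" using fp unfolding U_def l_def by simp
  finally have "(\<Sum>m<p. - (t \<bullet> (U m - U (Suc m)))) = 0" by simp
  moreover have "\<And>m. m \<in> {..<p} \<Longrightarrow> 0 \<le> - (t \<bullet> (U m - U (Suc m)))"
    using strict by (metis diff_self inner_zero_right lessThan_iff less_eq_real_def neg_0_le_iff_le order_refl)
  ultimately have zero: "\<forall>m\<in>{..<p}. - (t \<bullet> (U m - U (Suc m))) = 0"
    using sum_nonneg_eq_0_iff[of "{..<p}" "\<lambda>m. - (t \<bullet> (U m - U (Suc m)))"] by blast
  have step: "U m = U (Suc m)" if "m < p" for m
    using zero strict[OF that] that by force
  have const: "m \<le> p \<Longrightarrow> U m = U 0" for m
    by (induction m) (use step in \<open>auto simp: Suc_le_eq\<close>)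
  have "0 = f p - f 0" using fp by simp
  also have "\<dots> = (\<Sum>m<p. f (Suc m) - f m)" by (rule sum_lessThan_telescope[symmetric])
  also have "\<dots> = (\<Sum>m<p. l m) *\<^sub>R U 0"
    unfolding scaleR_sum_left
  proof (rule sum.cong)
    fix m assume "m \<in> {..<p}"
    then have "U m = U 0" by (intro const) simp
    then show "f (Suc m) - f m = l m *\<^sub>R U 0" using lU[of m] by simp
  qed simp
  finally have "(\<Sum>m<p. l m) *\<^sub>R U 0 = 0" by simp
  moreover have "(\<Sum>m<p. l m) > 0" using lpos p by (intro sum_pos) (auto simp: lessThan_empty_iff)
  moreover have "U 0 \<noteq> 0" using lU[of 0] ne[of 0] by auto
  ultimately show False by simp
qed

text \<open>Helly's theorem for an indexed family. The members may coincide, so the family may have fewer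
  than three distinct members, a case that the theorem for sets excludes.\<close>

lemma Helly_indexed:
  fixes C :: "'i \<Rightarrow> plane set"
  assumes fin: "finite I" and ne: "I \<noteq> {}" and conv: "\<And>i. i \<in> I \<Longrightarrow> convex (C i)"
    and three: "\<And>i j k. i \<in> I \<Longrightarrow> j \<in> I \<Longrightarrow> k \<in> I \<Longrightarrow> C i \<inter> C j \<inter> C k \<noteq> {}"
  shows "(\<Inter>i\<in>I. C i) \<noteq> {}"
proof (cases "card (C ` I) \<ge> 3")
  case True
  show ?thesis
  proof (rule Helly)
    show "DIM(plane) + 1 \<le> card (C ` I)" using True by simp
    show "\<forall>s\<in>C ` I. convex s" using conv by blast
    fix F assume F: "F \<subseteq> C ` I" "card F = DIM(plane) + 1"
    then have "card F = 3" by simp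
    then obtain X Y Z where "F = {X, Y, Z}" by (auto simp: card_3_iff)
    with F(1) obtain i j k where "i \<in> I" "j \<in> I" "k \<in> I" "F = {C i, C j, C k}" by auto
    then show "\<Inter>F \<noteq> {}" using three by (simp add: Int_assoc)
  qed
next
  case False
  then have le: "card (C ` I) \<le> 2" by simp
  obtain i where i: "i \<in> I" using ne by blast
  have "\<exists>j\<in>I. C ` I = {C i, C j}"
  proof (cases "C ` I = {C i}")
    case False
    then obtain j where j: "j \<in> I" "C j \<noteq> C i" using i by blast
    have "{C i, C j} = C ` I"
      by (rule card_seteq) (use fin i j le in auto)
    then show ?thesis using j(1) by metis
  qed (use i in auto)
  with i obtain j where "i \<in> I" "j \<in> I" "C ` I = {C i, C j}" by blast
  then show ?thesis using three[of i j j] by auto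
qed


lemma billiard_orbit_untranslatable_triple:
  assumes orb: "generalised_billiard_orbit T q" and per: "has_period q p" and T: "convex T"
  obtains i j k where "i \<le> j" "j \<le> k" "k < p"
    "untranslatable T (q (int i)) (q (int j)) (q (int k))"
proof -
  define C where "C m = {t. q (int m) + t \<in> interior T}" for m
  have p: "p > 0" using per unfolding has_period_def by simp
  have "convex (C m)" for m
  proof -
    have "C m = (+) (- q (int m)) ` interior T"
      unfolding C_def by (force simp: image_iff algebra_simps)
    then show ?thesis using T by (simp add: convex_translation)
  qed
  moreover have "(\<Inter>m\<in>{..<p}. C m) = {}"
    using billiard_orbit_untranslatable[OF orb per] unfolding C_def by blast
  ultimately obtain i j k where ijk: "i < p" "j < p" "k < p" "C i \<inter> C j \<inter> C k = {}"
    using Helly_indexed[of "{..<p}" C] p by blast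
  then have "untranslatable T (q (int i)) (q (int j)) (q (int k))"
    unfolding untranslatable_def C_def by blast
  moreover define R where "R i j k \<longleftrightarrow> i < p \<and> j < p \<and> k < p \<and>
    untranslatable T (q (int i)) (q (int j)) (q (int k))" for i j k
  ultimately have R1: "R i j k" using ijk by simp
  have R: "R i j k \<Longrightarrow> R j i k" "R i j k \<Longrightarrow> R i k j" for i j k
    unfolding R_def using untranslatable_swap by blast+
  note R2 = R(1)[OF R1] R(2)[OF R1]
  note R3 = R(2)[OF R2(1)] R(1)[OF R2(2)]
  have "\<exists>i j k. i \<le> j \<and> j \<le> k \<and> R i j k"
    by (rule le_cases3[of i j k]) (use R1 R2 R3 R(1)[OF R3(1)] in blast)+
  then show ?thesis using that unfolding R_def by blast
qed

text \<open>The three vertices cut a period of the orbit, started at the first of them, into three paths,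
  each at least as long as the corresponding side.\<close>

lemma billiard_orbit_triangle:
  assumes orb: "generalised_closed_orbit T q" and T: "compact T" "convex T"
  obtains a b c where "a \<in> T" "b \<in> T" "c \<in> T" "untranslatable T a b c"
    "perimeter a b c \<le> orbit_length q"
    "perimeter a b c = orbit_length q \<longrightarrow> orbit_trace q = sides a b c"
proof -
  define p where "p = minimal_period q"
  have bo: "generalised_billiard_orbit T q"
    using orb unfolding generalised_closed_orbit_def by blast
  have per: "has_period q p"
    using orb has_period_minimal_period unfolding generalised_closed_orbit_def p_def by blast
  obtain i j k where ijk: "i \<le> j" "j \<le> k" "k < p"
    and nt: "untranslatable T (q (int i)) (q (int j)) (q (int k))"
    using billiard_orbit_untranslatable_triple[OF bo per T(2)] .
  define f where "f m = q (int m)" for m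
  have f_per: "f (m + p) = f m" for m
    using per unfolding has_period_def f_def by simp
  have inT: "f m \<in> T" for m
  proof -
    have "f m \<in> frontier T"
      using bo unfolding generalised_billiard_orbit_def f_def by blast
    then show ?thesis using T(1) frontier_subset_closed[of T] compact_imp_closed by blast
  qed
  define g where "g m = dist (f m) (f (Suc m))" for m
  define B where "B m = closed_segment (f m) (f (Suc m))" for m
  have "orbit_length q = (\<Sum>m<p. g m)"
    unfolding orbit_length_def p_def g_def f_def by (simp add: dist_norm norm_minus_commute add.commute)
  also have "\<dots> = (\<Sum>m\<in>{i..<i + p}. g m)"
    using f_per ijk by (intro sum_one_period[symmetric]) (use f_per[of "Suc _"] in \<open>auto simp: g_def\<close>)
  also have "\<dots> = (\<Sum>m\<in>{i..<j}. g m) + (\<Sum>m\<in>{j..<k}. g m) + (\<Sum>m\<in>{k..<i + p}. g m)"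
    using ijk by (simp add: sum.atLeastLessThan_concat)
  finally have len: "orbit_length q = (\<Sum>m\<in>{i..<j}. g m) + (\<Sum>m\<in>{j..<k}. g m) + (\<Sum>m\<in>{k..<i + p}. g m)" .
  have le: "dist (f i) (f j) \<le> (\<Sum>m\<in>{i..<j}. g m)" "dist (f j) (f k) \<le> (\<Sum>m\<in>{j..<k}. g m)"
    "dist (f k) (f i) \<le> (\<Sum>m\<in>{k..<i + p}. g m)"
    unfolding g_def using ijk path_length_ge_dist[of i j f] path_length_ge_dist[of j k f]
      path_length_ge_dist[of k "i + p" f] f_per[of i] by simp_all
  show ?thesis
  proof (rule that)
    show "f i \<in> T" "f j \<in> T" "f k \<in> T" by (rule inT)+
    show "untranslatable T (f i) (f j) (f k)" using nt unfolding f_def .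
    show "perimeter (f i) (f j) (f k) \<le> orbit_length q"
      unfolding perimeter_def len using le by linarith
    show "perimeter (f i) (f j) (f k) = orbit_length q \<longrightarrow> orbit_trace q = sides (f i) (f j) (f k)"
    proof
      assume eq: "perimeter (f i) (f j) (f k) = orbit_length q"
      then have eqs: "(\<Sum>m\<in>{i..<j}. g m) = dist (f i) (f j)" "(\<Sum>m\<in>{j..<k}. g m) = dist (f j) (f k)"
        "(\<Sum>m\<in>{k..<i + p}. g m) = dist (f k) (f (i + p))"
        unfolding perimeter_def len f_per using le by linarith+
      have sides: "insert (f i) (\<Union>m\<in>{i..<j}. B m) = closed_segment (f i) (f j)"
        "insert (f j) (\<Union>m\<in>{j..<k}. B m) = closed_segment (f j) (f k)"
        "insert (f k) (\<Union>m\<in>{k..<i + p}. B m) = closed_segment (f k) (f i)"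
        unfolding B_def using ijk eqs path_straight[of i j f] path_straight[of j k f]
          path_straight[of k "i + p" f] f_per[of i] unfolding g_def by simp_all
      have "orbit_trace q = (\<Union>m\<in>{i..<i + p}. B m)"
        unfolding B_def f_def by (rule orbit_trace_one_period[OF per])
      also have "\<dots> = insert (f i) (\<Union>m\<in>{i..<j}. B m) \<union> insert (f j) (\<Union>m\<in>{j..<k}. B m)
          \<union> insert (f k) (\<Union>m\<in>{k..<i + p}. B m)" (is "?L = ?R")
      proof
        have "{i..<i + p} = {i..<j} \<union> {j..<k} \<union> {k..<i + p}" using ijk by auto
        then show "?L \<subseteq> ?R" by blast
        have "f i \<in> B i" "f j \<in> B j" "f k \<in> B k" unfolding B_def by auto
        then show "?R \<subseteq> ?L" using ijk by fastforce
      qed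
      also have "\<dots> = sides (f i) (f j) (f k)" unfolding sides_def sides ..
      finally show "orbit_trace q = sides (f i) (f j) (f k)" .
    qed
  qed
qed


section \<open>From shortest triangles to closed orbits\<close>

definition realised :: "plane set \<Rightarrow> plane \<Rightarrow> plane \<Rightarrow> plane \<Rightarrow> bool" where
  "realised T a b c \<longleftrightarrow> (\<exists>q. generalised_closed_orbit T q \<and>
     orbit_length q = perimeter a b c \<and> orbit_trace q = sides a b c)"

lemma realised_swap:
  "realised T b a c \<longleftrightarrow> realised T a b c"
  "realised T a c b \<longleftrightarrow> realised T a b c"
  unfolding realised_def by (simp_all add: perimeter_swap sides_swap)

lemma realised_two_bounce:
  assumes ab: "a \<noteq> b"
    and a: "outward_support_vector T a (2 *\<^sub>R ((1 / norm (a - b)) *\<^sub>R (a - b)))"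
    and b: "outward_support_vector T b (2 *\<^sub>R ((1 / norm (b - a)) *\<^sub>R (b - a)))"
  shows "realised T a b b"
proof -
  define q :: "int \<Rightarrow> plane" where "q i = (if even i then a else b)" for i
  have per: "has_period q 2" unfolding has_period_def q_def by simp
  have "generalised_billiard_orbit T q"
    unfolding generalised_billiard_orbit_def
  proof
    fix i
    show "q i \<in> frontier T \<and> q (i + 1) \<noteq> q i \<and>
        outward_support_vector T (q i)
          ((1 / norm (q i - q (i - 1))) *\<^sub>R (q i - q (i - 1)) +
           (1 / norm (q i - q (i + 1))) *\<^sub>R (q i - q (i + 1)))"
      using ab a[unfolded scaleR_2] b[unfolded scaleR_2] unfolding q_def
      by (cases "even i") (auto simp: outward_support_vector_def)
  qed
  moreover have mp: "minimal_period q = 2"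
    unfolding minimal_period_def
    by (rule Least_equality[of _ 2]) (use per in \<open>auto simp: has_period_def\<close>)
  have "orbit_length q = perimeter a b b"
    unfolding orbit_length_def mp perimeter_def
    by (simp add: numeral_2_eq_2 q_def dist_norm norm_minus_commute)
  moreover have "orbit_trace q = sides a b b"
  proof
    show "orbit_trace q \<subseteq> sides a b b"
      unfolding orbit_trace_def sides_def q_def by (auto simp: closed_segment_commute split: if_splits)
    have "closed_segment (q 0) (q (0 + 1)) \<subseteq> orbit_trace q"
      unfolding orbit_trace_def by blast
    then show "sides a b b \<subseteq> orbit_trace q"
      unfolding sides_def q_def by (auto simp: closed_segment_commute)
  qed
  ultimately show ?thesis
    unfolding realised_def generalised_closed_orbit_def using per by blast
qed

lemma realised_three_bounce:
  assumes ne: "a \<noteq> b" "b \<noteq> c" "c \<noteq> a"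
    and a: "outward_support_vector T a
      ((1 / norm (a - c)) *\<^sub>R (a - c) + (1 / norm (a - b)) *\<^sub>R (a - b))"
    and b: "outward_support_vector T b
      ((1 / norm (b - a)) *\<^sub>R (b - a) + (1 / norm (b - c)) *\<^sub>R (b - c))"
    and c: "outward_support_vector T c
      ((1 / norm (c - b)) *\<^sub>R (c - b) + (1 / norm (c - a)) *\<^sub>R (c - a))"
  shows "realised T a b c"
proof -
  define q :: "int \<Rightarrow> plane"
    where "q i = (if i mod 3 = 0 then a else if i mod 3 = 1 then b else c)" for i
  have per: "has_period q 3" unfolding has_period_def q_def by simp
  have cases3: "(q (i - 1), q i, q (i + 1)) \<in> {(c, a, b), (a, b, c), (b, c, a)}" for i
  proof -
    have "i mod 3 = 0 \<or> i mod 3 = 1 \<or> i mod 3 = 2" by presburger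
    then consider "i mod 3 = 0" | "i mod 3 = 1" | "i mod 3 = 2" by blast
    then show ?thesis
    proof cases
      case 1
      then have "(i - 1) mod 3 = 2" "(i + 1) mod 3 = 1" by presburger+
      with 1 show ?thesis by (simp add: q_def)
    next
      case 2
      then have "(i - 1) mod 3 = 0" "(i + 1) mod 3 = 2" by presburger+
      with 2 show ?thesis by (simp add: q_def)
    next
      case 3
      then have "(i - 1) mod 3 = 1" "(i + 1) mod 3 = 0" by presburger+
      with 3 show ?thesis by (simp add: q_def)
    qed
  qed
  have "generalised_billiard_orbit T q"
    unfolding generalised_billiard_orbit_def
  proof
    fix i
    show "q i \<in> frontier T \<and> q (i + 1) \<noteq> q i \<and>
        outward_support_vector T (q i)
          ((1 / norm (q i - q (i - 1))) *\<^sub>R (q i - q (i - 1)) +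
           (1 / norm (q i - q (i + 1))) *\<^sub>R (q i - q (i + 1)))"
      using cases3[of i] a b c ne by (auto simp: outward_support_vector_def)
  qed
  moreover have q012: "q 0 = a" "q 1 = b" "q 2 = c" "q 3 = a" by (simp_all add: q_def)
  have mp: "minimal_period q = 3"
    unfolding minimal_period_def
  proof (rule Least_equality)
    show "has_period q 3" by (rule per)
    fix n assume n: "has_period q n"
    show "3 \<le> n"
    proof (rule ccontr)
      assume "\<not> 3 \<le> n"
      then have "n = 2" using n unfolding has_period_def by simp
      then have "q (0 + int 2) = q 0" using n unfolding has_period_def by blast
      then show False using q012 ne by simp
    qed
  qed
  have "orbit_length q = perimeter a b c"
    unfolding orbit_length_def mp perimeter_def
    by (simp add: numeral_3_eq_3 q012 dist_norm norm_minus_commute)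
  moreover have "orbit_trace q = sides a b c"
  proof
    show "orbit_trace q \<subseteq> sides a b c"
    proof -
      have "closed_segment (q i) (q (i + 1)) \<subseteq> sides a b c" for i
        using cases3[of i] unfolding sides_def by auto
      then show ?thesis unfolding orbit_trace_def by blast
    qed
    have "closed_segment (q i) (q (i + 1)) \<subseteq> orbit_trace q" for i
      unfolding orbit_trace_def by blast
    from this[of 0] this[of 1] this[of 2]
    show "sides a b c \<subseteq> orbit_trace q" unfolding sides_def by (simp add: q012)
  qed
  ultimately show ?thesis
    unfolding realised_def generalised_closed_orbit_def using per by blast
qed

lemma untranslatable_not_point:
  assumes "interior T \<noteq> {}" "untranslatable T a b c"
  shows "\<not> (a = b \<and> b = c)"
proof
  assume "a = b \<and> b = c"
  moreover obtain z where "z \<in> interior T" using assms by blast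
  ultimately have "a + (z - a) \<in> interior T \<and> b + (z - a) \<in> interior T \<and> c + (z - a) \<in> interior T"
    by auto
  then show False using assms(2) unfolding untranslatable_def by blast
qed

text \<open>Here the two normals at \<open>b\<close> combine to \<open>- u\<close>, so \<open>T\<close> lies in the strip between the lines
  through \<open>a\<close> and \<open>b\<close> orthogonal to \<open>u\<close>. Any segment crossing this strip is untranslatable, hence
  minimality forces \<open>a - b\<close> to be orthogonal to the strip.\<close>

lemma shortest_two_gon_realised:
  assumes T: "convex_body T" and sh: "shortest_triangle T a b b"
  shows "realised T a b b"
proof -
  have cT: "convex T" "interior T \<noteq> {}" using T unfolding convex_body_def by auto
  have abT: "a \<in> T" "b \<in> T" and nt: "untranslatable T a b b"
    and min: "\<And>x y z. untranslatable T x y z \<Longrightarrow> perimeter a b b \<le> perimeter x y z"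
    using sh unfolding shortest_triangle_def by auto
  have ab: "a \<noteq> b" using untranslatable_not_point[OF cT(2) nt] by simp
  obtain u v w where uvw: "u + v + w = 0" "u \<noteq> 0 \<or> v \<noteq> 0 \<or> w \<noteq> 0"
    and sup: "\<forall>x\<in>T. u \<bullet> x \<le> u \<bullet> a" "\<forall>x\<in>T. v \<bullet> x \<le> v \<bullet> b" "\<forall>x\<in>T. w \<bullet> x \<le> w \<bullet> b"
    by (rule untranslatable_obtain_normals[OF cT abT(1) abT(2) abT(2) nt])
  have vw: "w = - u - v" using uvw(1) by (simp add: algebra_simps eq_neg_iff_add_eq_0)
  have low: "u \<bullet> b \<le> u \<bullet> x" if "x \<in> T" for x
    using sup(2,3) that unfolding vw by (fastforce simp: inner_diff_left)
  have u0: "u \<noteq> 0"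
  proof
    assume u: "u = 0"
    obtain z where z: "z \<in> interior T" using cT by blast
    have "v \<noteq> 0" "w \<noteq> 0" using uvw u by auto
    then have "v \<bullet> z < v \<bullet> b" "w \<bullet> z < w \<bullet> b"
      using support_less_interior[OF z] sup by blast+
    then show False unfolding vw u by simp
  qed
  define h where "h = u \<bullet> (a - b)"
  have h: "h \<ge> 0" unfolding h_def using sup(1) abT by (simp add: inner_diff_right)
  define x where "x = b + (h / (u \<bullet> u)) *\<^sub>R u"
  have ux: "u \<bullet> x = u \<bullet> b + h"
    unfolding x_def using u0 by (simp add: inner_add_right)
  have "untranslatable T x b b"
  proof (rule untranslatable_by_normals[OF uvw sup])
    show "u \<bullet> a + v \<bullet> b + w \<bullet> b \<le> u \<bullet> x + v \<bullet> b + w \<bullet> b"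
      using ux unfolding h_def by (simp add: inner_diff_right)
  qed
  from min[OF this] have "norm (a - b) \<le> norm (x - b)"
    unfolding perimeter_def by (simp add: dist_norm norm_minus_commute)
  also have "norm (x - b) = h / norm u"
    unfolding x_def using h u0 by (simp add: dot_square_norm power2_eq_square)
  finally have "norm u * norm (a - b) \<le> h" using u0 by (simp add: pos_le_divide_eq mult.commute)
  moreover have "h \<le> norm u * norm (a - b)" unfolding h_def by (rule norm_cauchy_schwarz)
  ultimately have "u \<bullet> (a - b) = norm u * norm (a - b)" unfolding h_def by simp
  then have par: "norm u *\<^sub>R (a - b) = norm (a - b) *\<^sub>R u"
    by (simp add: norm_cauchy_schwarz_eq)
  define r where "r = 2 / norm u"
  have r: "r > 0" unfolding r_def using u0 by simp
  have e: "2 *\<^sub>R ((1 / norm (a - b)) *\<^sub>R (a - b)) = r *\<^sub>R u"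
  proof -
    have "a - b = (1 / norm u) *\<^sub>R (norm u *\<^sub>R (a - b))" using u0 by simp
    also have "\<dots> = (norm (a - b) / norm u) *\<^sub>R u" unfolding par by simp
    finally have "(1 / norm (a - b)) *\<^sub>R (a - b) = (1 / norm (a - b)) *\<^sub>R ((norm (a - b) / norm u) *\<^sub>R u)"
      by simp
    then show ?thesis unfolding r_def using ab by simp
  qed
  have e': "2 *\<^sub>R ((1 / norm (b - a)) *\<^sub>R (b - a)) = - (r *\<^sub>R u)"
    unfolding e[symmetric] by (simp add: norm_minus_commute algebra_simps)
  show ?thesis
  proof (rule realised_two_bounce[OF ab])
    show "outward_support_vector T a (2 *\<^sub>R ((1 / norm (a - b)) *\<^sub>R (a - b)))"
      unfolding e by (rule outward_support_vector_scaleR[OF abT(1) u0 sup(1) r])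
    have "outward_support_vector T b (r *\<^sub>R (- u))"
      by (rule outward_support_vector_scaleR[OF abT(2) _ _ r]) (use u0 low in auto)
    then show "outward_support_vector T b (2 *\<^sub>R ((1 / norm (b - a)) *\<^sub>R (b - a)))"
      unfolding e' by simp
  qed
qed

text \<open>If two of the vertices alone are untranslatable, minimality makes the third one
  lie on the segment between them. The third vertex may then be an interior point of \<open>T\<close>, so
  only the other two can be taken as bounce points; the trace is unchanged.\<close>

lemma degenerate_shortest_triangle_realised:
  assumes T: "convex_body T" and sh: "shortest_triangle T a b c" and nt: "untranslatable T b c c"
  shows "realised T a b c"
proof -
  have tri: "perimeter b c c \<le> perimeter a b c"
    unfolding perimeter_def using dist_triangle[of b c a] by (simp add: dist_commute)
  have sh': "shortest_triangle T b c c"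
    using sh nt tri unfolding shortest_triangle_def by force
  have eq: "perimeter b c c = perimeter a b c"
    using sh nt tri unfolding shortest_triangle_def by force
  then have "dist b c = dist b a + dist a c"
    unfolding perimeter_def by (simp add: dist_commute)
  then have "a \<in> closed_segment b c" by (simp add: between between_mem_segment[symmetric])
  from Un_closed_segment[OF this] have "sides b c c = sides a b c"
    unfolding sides_def by (auto simp: closed_segment_commute)
  then show ?thesis
    using shortest_two_gon_realised[OF T sh'] eq unfolding realised_def by simp
qed

lemma gradient_of_two_distances:
  fixes a b c u :: "'a::real_inner"
  assumes ne: "a \<noteq> b" "a \<noteq> c"
    and le: "\<And>x. u \<bullet> x + k \<le> dist x b + dist x c" and eq: "u \<bullet> a + k = dist a b + dist a c"
  shows "u = (1 / norm (a - b)) *\<^sub>R (a - b) + (1 / norm (a - c)) *\<^sub>R (a - c)" (is "_ = ?g")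
proof -
  let ?f = "\<lambda>x. norm (x - b) + norm (x - c) - u \<bullet> x"
  have nd: "((\<lambda>x. norm (x - d)) has_derivative (\<lambda>h. ((1 / norm (a - d)) *\<^sub>R (a - d)) \<bullet> h)) (at a)"
    if "a \<noteq> d" for d
  proof -
    have "((\<lambda>x. x - d) has_derivative (\<lambda>h. h)) (at a)"
      by (auto intro!: derivative_eq_intros)
    from has_derivative_compose[OF this has_derivative_norm] that
    show ?thesis by (simp add: sgn_div_norm inner_commute divide_inverse)
  qed
  have D: "(?f has_derivative (\<lambda>h. ((1 / norm (a - b)) *\<^sub>R (a - b)) \<bullet> h +
      ((1 / norm (a - c)) *\<^sub>R (a - c)) \<bullet> h - u \<bullet> h)) (at a)"
    using nd[OF ne(1)] nd[OF ne(2)]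
    by (intro has_derivative_diff has_derivative_add has_derivative_inner_right has_derivative_ident)
  have "(\<lambda>h. ((1 / norm (a - b)) *\<^sub>R (a - b)) \<bullet> h +
      ((1 / norm (a - c)) *\<^sub>R (a - c)) \<bullet> h - u \<bullet> h) = (\<lambda>h. 0)"
  proof (rule has_derivative_local_min[OF D])
    have "?f a \<le> ?f x" for x using le[of x] eq unfolding dist_norm by linarith
    then show "\<forall>\<^sub>F x in at a. ?f a \<le> ?f x" by simp
  qed
  then have "(?g - u) \<bullet> h = 0" for h
    by (metis (no_types, lifting) inner_add_left inner_diff_left)
  then have "?g - u = 0" by (metis inner_eq_zero_iff)
  then show ?thesis by simp
qed

text \<open>Scaling an arbitrary triple until \<open>u \<bullet> x + v \<bullet> y + w \<bullet> z\<close> reaches its value at \<open>(a, b, c)\<close>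
  makes it untranslatable. By minimality the perimeter is therefore bounded below by a positive
  multiple \<open>l\<close> of this linear functional on all triples, with equality at \<open>(a, b, c)\<close>. Varying one
  vertex at a time identifies the scaled normals with the gradients of the perimeter.\<close>

lemma shortest_triangle_realised:
  assumes T: "convex_body T" and sh: "shortest_triangle T a b c"
  shows "realised T a b c"
proof (cases "untranslatable T b c c \<or> untranslatable T a c c \<or> untranslatable T a b b")
  case True
  then show ?thesis
    using degenerate_shortest_triangle_realised[OF T sh]
      degenerate_shortest_triangle_realised[OF T shortest_triangle_swap(1)[OF sh]]
      degenerate_shortest_triangle_realised[OF T shortest_triangle_swap(1)[OF shortest_triangle_swap(2)[OF sh]]]
    by (auto simp: realised_swap)
next
  case False
  have cT: "convex T" "interior T \<noteq> {}" using T unfolding convex_body_def by auto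
  have abc: "a \<in> T" "b \<in> T" "c \<in> T" and nt: "untranslatable T a b c"
    and min: "\<And>x y z. untranslatable T x y z \<Longrightarrow> perimeter a b c \<le> perimeter x y z"
    using sh unfolding shortest_triangle_def by auto
  have ne: "a \<noteq> b" "b \<noteq> c" "c \<noteq> a"
    using False nt unfolding untranslatable_def by auto
  obtain u v w where uvw: "u + v + w = 0" "u \<noteq> 0 \<or> v \<noteq> 0 \<or> w \<noteq> 0"
    and sup: "\<forall>x\<in>T. u \<bullet> x \<le> u \<bullet> a" "\<forall>x\<in>T. v \<bullet> x \<le> v \<bullet> b" "\<forall>x\<in>T. w \<bullet> x \<le> w \<bullet> c"
    by (rule untranslatable_obtain_normals[OF cT abc nt])
  note nt_normals = untranslatable_by_normals[OF uvw sup]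
  \<comment> \<open>If one normal vanishes, the other two already certify that a pair is untranslatable.\<close>
  have nz: "u \<noteq> 0" "v \<noteq> 0" "w \<noteq> 0"
  proof -
    show "u \<noteq> 0" using nt_normals[of c b c] False untranslatable_swap by (metis inner_zero_left order_refl)
    show "v \<noteq> 0" using nt_normals[of a c c] False by (metis inner_zero_left order_refl)
    show "w \<noteq> 0" using nt_normals[of a b b] False by (metis inner_zero_left order_refl)
  qed
  define H where "H = u \<bullet> a + v \<bullet> b + w \<bullet> c"
  have H: "H > 0"
  proof -
    obtain z where z: "z \<in> interior T" using cT by blast
    have "u \<bullet> z < u \<bullet> a" "v \<bullet> z < v \<bullet> b" "w \<bullet> z < w \<bullet> c"
      using support_less_interior[OF z] nz sup by blast+
    moreover have "u \<bullet> z + v \<bullet> z + w \<bullet> z = 0" using uvw(1) by (metis inner_add_left inner_zero_left)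
    ultimately show ?thesis unfolding H_def by linarith
  qed
  define l where "l = perimeter a b c / H"
  have "perimeter a b c > 0" unfolding perimeter_def using ne by (simp add: add_pos_nonneg)
  then have l: "l > 0" unfolding l_def using H by simp
  have dual: "l * (u \<bullet> x + v \<bullet> y + w \<bullet> z) \<le> perimeter x y z" for x y z
  proof (cases "u \<bullet> x + v \<bullet> y + w \<bullet> z > 0")
    case True
    define s where "s = H / (u \<bullet> x + v \<bullet> y + w \<bullet> z)"
    have s: "s > 0" unfolding s_def using True H by simp
    have "untranslatable T (s *\<^sub>R x) (s *\<^sub>R y) (s *\<^sub>R z)"
    proof (rule nt_normals)
      have "u \<bullet> (s *\<^sub>R x) + v \<bullet> (s *\<^sub>R y) + w \<bullet> (s *\<^sub>R z) = s * (u \<bullet> x + v \<bullet> y + w \<bullet> z)"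
        by (simp add: distrib_left)
      also have "\<dots> = H" unfolding s_def using True by simp
      finally show "u \<bullet> a + v \<bullet> b + w \<bullet> c \<le> u \<bullet> (s *\<^sub>R x) + v \<bullet> (s *\<^sub>R y) + w \<bullet> (s *\<^sub>R z)"
        unfolding H_def by simp
    qed
    from min[OF this] have "perimeter a b c \<le> s * perimeter x y z"
      using s by (simp add: perimeter_scaleR)
    then show ?thesis unfolding l_def s_def using True H by (simp add: field_simps)
  next
    case False
    then have "l * (u \<bullet> x + v \<bullet> y + w \<bullet> z) \<le> 0" using l by (simp add: mult_nonneg_nonpos)
    then show ?thesis using perimeter_nonneg order_trans by blast
  qed
  have tight: "l * (u \<bullet> a + v \<bullet> b + w \<bullet> c) = perimeter a b c"
    unfolding l_def H_def[symmetric] using H by simp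
  have gu: "l *\<^sub>R u = (1 / norm (a - c)) *\<^sub>R (a - c) + (1 / norm (a - b)) *\<^sub>R (a - b)"
  proof (rule gradient_of_two_distances)
    show "(l *\<^sub>R u) \<bullet> x + (l * (v \<bullet> b + w \<bullet> c) - dist b c) \<le> dist x c + dist x b" for x
      using dual[of x b c] unfolding perimeter_def by (simp add: algebra_simps dist_commute)
    show "(l *\<^sub>R u) \<bullet> a + (l * (v \<bullet> b + w \<bullet> c) - dist b c) = dist a c + dist a b"
      using tight unfolding perimeter_def by (simp add: algebra_simps dist_commute)
  qed (use ne in auto)
  have gv: "l *\<^sub>R v = (1 / norm (b - a)) *\<^sub>R (b - a) + (1 / norm (b - c)) *\<^sub>R (b - c)"
  proof (rule gradient_of_two_distances)
    show "(l *\<^sub>R v) \<bullet> x + (l * (u \<bullet> a + w \<bullet> c) - dist c a) \<le> dist x a + dist x c" for x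
      using dual[of a x c] unfolding perimeter_def by (simp add: algebra_simps dist_commute)
    show "(l *\<^sub>R v) \<bullet> b + (l * (u \<bullet> a + w \<bullet> c) - dist c a) = dist b a + dist b c"
      using tight unfolding perimeter_def by (simp add: algebra_simps dist_commute)
  qed (use ne in auto)
  have gw: "l *\<^sub>R w = (1 / norm (c - b)) *\<^sub>R (c - b) + (1 / norm (c - a)) *\<^sub>R (c - a)"
  proof (rule gradient_of_two_distances)
    show "(l *\<^sub>R w) \<bullet> x + (l * (u \<bullet> a + v \<bullet> b) - dist a b) \<le> dist x b + dist x a" for x
      using dual[of a b x] unfolding perimeter_def by (simp add: algebra_simps dist_commute)
    show "(l *\<^sub>R w) \<bullet> c + (l * (u \<bullet> a + v \<bullet> b) - dist a b) = dist c b + dist c a"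
      using tight unfolding perimeter_def by (simp add: algebra_simps dist_commute)
  qed (use ne in auto)
  show ?thesis
  proof (rule realised_three_bounce[OF ne])
    show "outward_support_vector T a
      ((1 / norm (a - c)) *\<^sub>R (a - c) + (1 / norm (a - b)) *\<^sub>R (a - b))"
      unfolding gu[symmetric] by (rule outward_support_vector_scaleR[OF abc(1) nz(1) sup(1) l])
    show "outward_support_vector T b
      ((1 / norm (b - a)) *\<^sub>R (b - a) + (1 / norm (b - c)) *\<^sub>R (b - c))"
      unfolding gv[symmetric] by (rule outward_support_vector_scaleR[OF abc(2) nz(2) sup(2) l])
    show "outward_support_vector T c
      ((1 / norm (c - b)) *\<^sub>R (c - b) + (1 / norm (c - a)) *\<^sub>R (c - a))"
      unfolding gw[symmetric] by (rule outward_support_vector_scaleR[OF abc(3) nz(3) sup(3) l])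
  qed
qed


section \<open>Existence of shortest triangles and the minimal length\<close>

lemma perimeter_add: "perimeter (a + t) (b + t) (c + t) = perimeter a b c"
  unfolding perimeter_def by simp

lemma closed_untranslatable: "closed {(a, b, c). untranslatable T a b c}"
proof -
  have "- {(a, b, c). untranslatable T a b c} =
      (\<Union>t. {p. fst p + t \<in> interior T} \<inter> {p. fst (snd p) + t \<in> interior T} \<inter>
            {p. snd (snd p) + t \<in> interior T})"
    unfolding untranslatable_def by (auto simp: split_def)
  moreover have "open \<dots>"
    by (intro open_UN open_Int ballI open_vimage[unfolded vimage_def, OF open_interior] continuous_intros)
  ultimately show ?thesis by (simp add: closed_def)
qed

text \<open>The largest factor \<open>s \<le> 1\<close> for which a copy of the triangle scaled by \<open>s\<close> fits into \<open>T\<close>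
  exists by compactness. This copy is untranslatable: otherwise it could be moved into the interior
  and enlarged a little. This confines the search for a shortest triangle to a compact set.\<close>

lemma untranslatable_shrink_into:
  assumes T: "convex_body T" and nt: "untranslatable T x y z"
  obtains a b c where "a \<in> T" "b \<in> T" "c \<in> T" "untranslatable T a b c"
    "perimeter a b c \<le> perimeter x y z"
proof -
  have cT: "compact T" "interior T \<noteq> {}" using T unfolding convex_body_def by auto
  define C where "C = ({0..1::real} \<times> T) \<inter>
    ({r. snd r + fst r *\<^sub>R (y - x) \<in> T} \<inter> {r. snd r + fst r *\<^sub>R (z - x) \<in> T})"
  have "compact C"
    unfolding C_def using cT(1)
    by (intro compact_Int_closed compact_Times closed_Int
        closed_vimage[unfolded vimage_def] continuous_intros)
       (auto simp: compact_imp_closed)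
  moreover have "C \<noteq> {}"
  proof -
    obtain p0 where "p0 \<in> T" using cT interior_subset by blast
    then have "(0, p0) \<in> C" unfolding C_def by simp
    then show ?thesis by blast
  qed
  moreover have "continuous_on C fst" by (intro continuous_intros)
  ultimately have "\<exists>r\<in>C. \<forall>r'\<in>C. fst r' \<le> fst r" by (rule continuous_attains_sup)
  then obtain r where r: "r \<in> C" "\<And>r'. r' \<in> C \<Longrightarrow> fst r' \<le> fst r" by blast
  obtain s p where sp: "r = (s, p)" by (cases r)
  have s: "0 \<le> s" "s \<le> 1" and p: "p \<in> T" "p + s *\<^sub>R (y - x) \<in> T" "p + s *\<^sub>R (z - x) \<in> T"
    using r(1) unfolding sp C_def by auto
  have "untranslatable T p (p + s *\<^sub>R (y - x)) (p + s *\<^sub>R (z - x))"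
    unfolding untranslatable_def
  proof
    assume "\<exists>t. p + t \<in> interior T \<and> p + s *\<^sub>R (y - x) + t \<in> interior T \<and> p + s *\<^sub>R (z - x) + t \<in> interior T"
    then obtain t where t: "p + t \<in> interior T" "p + s *\<^sub>R (y - x) + t \<in> interior T"
      "p + s *\<^sub>R (z - x) + t \<in> interior T" by blast
    show False
    proof (cases "s = 1")
      case True
      then have "x + (p - x + t) \<in> interior T \<and> y + (p - x + t) \<in> interior T \<and> z + (p - x + t) \<in> interior T"
        using t by (simp add: algebra_simps)
      then show False using nt unfolding untranslatable_def by blast
    next
      case False
      let ?O = "{e. p + t + e *\<^sub>R (y - x) \<in> interior T} \<inter> {e. p + t + e *\<^sub>R (z - x) \<in> interior T}"
      have "open ?O"
        by (intro open_Int open_vimage[unfolded vimage_def, OF open_interior] continuous_intros)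
      moreover have "s \<in> ?O" using t by (simp add: algebra_simps)
      ultimately obtain d where d: "d > 0" "ball s d \<subseteq> ?O" by (meson open_contains_ball)
      define s' where "s' = s + min (d / 2) (1 - s)"
      have s': "s < s'" "s' \<le> 1" "s' \<in> ball s d"
        using d s False unfolding s'_def by (auto simp: dist_real_def)
      then have "(s', p + t) \<in> C"
        unfolding C_def using d t s s' interior_subset[of T] by auto
      then show False using r(2)[of "(s', p + t)"] s' unfolding sp by simp
    qed
  qed
  moreover have "perimeter p (p + s *\<^sub>R (y - x)) (p + s *\<^sub>R (z - x)) = s * perimeter x y z"
    using perimeter_add[of "s *\<^sub>R x" "p - s *\<^sub>R x" "s *\<^sub>R y" "s *\<^sub>R z"] s
    by (simp add: perimeter_scaleR algebra_simps)
  moreover have "s * perimeter x y z \<le> perimeter x y z"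
    using s perimeter_nonneg by (simp add: mult_left_le_one_le)
  ultimately show ?thesis using that p by simp
qed

lemma shortest_triangle_exists:
  assumes T: "convex_body T"
  obtains a b c where "shortest_triangle T a b c"
proof -
  have cT: "compact T" "interior T \<noteq> {}" using T unfolding convex_body_def by auto
  define S where "S = (T \<times> T \<times> T) \<inter> {(a, b, c). untranslatable T a b c}"
  have "compact S"
    unfolding S_def using cT by (intro compact_Int_closed compact_Times closed_untranslatable)
  moreover have "S \<noteq> {}"
  proof -
    obtain R where R: "\<And>x. x \<in> T \<Longrightarrow> norm x \<le> R"
      using compact_imp_bounded[OF cT(1)] bounded_iff by metis
    obtain e :: plane where e: "norm e = 1" using norm_Basis SOME_Basis by blast
    have "untranslatable T 0 ((2 * \<bar>R\<bar> + 1) *\<^sub>R e) 0"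
      unfolding untranslatable_def
    proof
      assume "\<exists>t. 0 + t \<in> interior T \<and> (2 * \<bar>R\<bar> + 1) *\<^sub>R e + t \<in> interior T \<and> 0 + t \<in> interior T"
      then obtain t where "t \<in> T" "(2 * \<bar>R\<bar> + 1) *\<^sub>R e + t \<in> T"
        using interior_subset[of T] by auto
      then have "norm t \<le> R" "norm ((2 * \<bar>R\<bar> + 1) *\<^sub>R e + t) \<le> R" using R by auto
      then have "norm ((2 * \<bar>R\<bar> + 1) *\<^sub>R e) \<le> R + R"
        using norm_triangle_ineq4[of "(2 * \<bar>R\<bar> + 1) *\<^sub>R e + t" t] by simp
      then show False using e by simp
    qed
    then show ?thesis
      by (rule untranslatable_shrink_into[OF T]) (auto simp: S_def)
  qed
  moreover have "continuous_on S (\<lambda>p. perimeter (fst p) (fst (snd p)) (snd (snd p)))"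
    unfolding perimeter_def by (intro continuous_intros)
  ultimately obtain p where p: "p \<in> S"
    "\<forall>r\<in>S. perimeter (fst p) (fst (snd p)) (snd (snd p)) \<le> perimeter (fst r) (fst (snd r)) (snd (snd r))"
    using continuous_attains_inf by blast
  obtain a b c where abc: "p = (a, b, c)" by (metis prod.exhaust)
  have "shortest_triangle T a b c"
    unfolding shortest_triangle_def
  proof (intro conjI allI impI)
    show "a \<in> T" "b \<in> T" "c \<in> T" "untranslatable T a b c" using p(1) unfolding abc S_def by auto
    fix x y z assume xyz: "untranslatable T x y z"
    obtain a' b' c' where "a' \<in> T" "b' \<in> T" "c' \<in> T" "untranslatable T a' b' c'"
      and le: "perimeter a' b' c' \<le> perimeter x y z"
      by (rule untranslatable_shrink_into[OF T xyz])
    then have "(a', b', c') \<in> S" unfolding S_def by simp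
    then show "perimeter a b c \<le> perimeter x y z" using p(2) le unfolding abc by force
  qed
  then show ?thesis by (rule that)
qed

lemma min_orbit_length_eq_perimeter:
  assumes T: "convex_body T" and sh: "shortest_triangle T a b c"
  shows "min_orbit_length T = perimeter a b c"
  unfolding min_orbit_length_def
proof (rule Least_equality)
  show "\<exists>q. generalised_closed_orbit T q \<and> perimeter a b c = orbit_length q"
    using shortest_triangle_realised[OF T sh] unfolding realised_def by metis
  fix l assume "\<exists>q. generalised_closed_orbit T q \<and> l = orbit_length q"
  then obtain q where q: "generalised_closed_orbit T q" "l = orbit_length q" by blast
  have "compact T" "convex T" using T unfolding convex_body_def by auto
  then obtain x y z where "untranslatable T x y z" "perimeter x y z \<le> l"
    unfolding q(2) by (rule billiard_orbit_triangle[OF q(1)])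
  then show "perimeter a b c \<le> l" using sh order_trans unfolding shortest_triangle_def by blast
qed

lemma minimal_orbit_triangle:
  assumes T: "convex_body T" and q: "q \<in> minimal_orbits T"
  obtains a b c where "shortest_triangle T a b c" "orbit_trace q = sides a b c"
proof -
  have orb: "generalised_closed_orbit T q" and len: "orbit_length q = min_orbit_length T"
    using q unfolding minimal_orbits_def by auto
  have cT: "compact T" "convex T" using T unfolding convex_body_def by auto
  obtain x y z where xyz: "shortest_triangle T x y z" using shortest_triangle_exists[OF T] .
  obtain a b c where abc: "a \<in> T" "b \<in> T" "c \<in> T" "untranslatable T a b c"
    and le: "perimeter a b c \<le> orbit_length q"
    and tr: "perimeter a b c = orbit_length q \<longrightarrow> orbit_trace q = sides a b c"
    by (rule billiard_orbit_triangle[OF orb cT])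
  have eq: "orbit_length q = perimeter x y z"
    using len min_orbit_length_eq_perimeter[OF T xyz] by simp
  then have "perimeter a b c = orbit_length q"
    using xyz abc le unfolding shortest_triangle_def by (simp add: antisym)
  moreover from this have "shortest_triangle T a b c"
    using xyz abc eq unfolding shortest_triangle_def by simp
  ultimately show ?thesis using that tr by blast
qed

lemma shortest_triangle_minimal_orbit:
  assumes T: "convex_body T" and sh: "shortest_triangle T a b c"
  obtains q where "q \<in> minimal_orbits T" "orbit_trace q = sides a b c"
  using shortest_triangle_realised[OF T sh] min_orbit_length_eq_perimeter[OF T sh]
  unfolding realised_def minimal_orbits_def by auto

section \<open>Convergence of traces\<close>

lemma closed_segment_close:
  fixes a :: "'a::real_normed_vector"
  assumes x: "x \<in> closed_segment a b" and d: "dist a a' \<le> e" "dist b b' \<le> e"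
  shows "\<exists>y\<in>closed_segment a' b'. dist x y \<le> e"
proof -
  obtain u where u: "0 \<le> u" "u \<le> 1" "x = (1 - u) *\<^sub>R a + u *\<^sub>R b"
    using x by (auto simp: in_segment)
  let ?y = "(1 - u) *\<^sub>R a' + u *\<^sub>R b'"
  have "x - ?y = (1 - u) *\<^sub>R (a - a') + u *\<^sub>R (b - b')"
    unfolding u by (simp add: algebra_simps)
  then have "dist x ?y \<le> (1 - u) * dist a a' + u * dist b b'"
    using u norm_triangle_ineq[of "(1 - u) *\<^sub>R (a - a')" "u *\<^sub>R (b - b')"]
    by (simp add: dist_norm)
  also have "\<dots> \<le> e" using u d by (intro convex_bound_le) auto
  finally show ?thesis using u(1,2) by (intro bexI[of _ ?y]) (auto simp: in_segment)
qed

lemma sides_close: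
  assumes "x \<in> sides a b c" "dist a a' \<le> e" "dist b b' \<le> e" "dist c c' \<le> e"
  shows "infdist x (sides a' b' c') \<le> e"
proof -
  have "\<exists>y\<in>sides a' b' c'. dist x y \<le> e"
    using assms(1) closed_segment_close[OF _ assms(2,3)] closed_segment_close[OF _ assms(3,4)]
      closed_segment_close[OF _ assms(4,2)] unfolding sides_def by blast
  then show ?thesis using infdist_le2 by blast
qed

text \<open>Nonnegativity has to be proved as well: a supremum of reals is meaningful only for
  a nonempty bounded set of values, and the bound comes from the closeness of the vertices.\<close>

lemma hausdorff_distance_sides:
  assumes d: "dist a a' \<le> e" "dist b b' \<le> e" "dist c c' \<le> e"
  shows "0 \<le> hausdorff_distance (sides a b c) (sides a' b' c')"
    "hausdorff_distance (sides a b c) (sides a' b' c') \<le> e"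
proof -
  have ne: "a \<in> sides a b c" "a' \<in> sides a' b' c'" unfolding sides_def by auto
  have le: "\<And>x. x \<in> sides a b c \<Longrightarrow> infdist x (sides a' b' c') \<le> e"
    "\<And>x. x \<in> sides a' b' c' \<Longrightarrow> infdist x (sides a b c) \<le> e"
    using d by (auto intro!: sides_close simp: dist_commute)
  show "hausdorff_distance (sides a b c) (sides a' b' c') \<le> e"
    unfolding hausdorff_distance_def using ne le by (auto intro!: cSUP_least)
  have "0 \<le> (SUP x\<in>sides a b c. infdist x (sides a' b' c'))"
    by (rule cSUP_upper2[OF _ ne(1)]) (auto intro!: bdd_aboveI2 le infdist_nonneg)
  then show "0 \<le> hausdorff_distance (sides a b c) (sides a' b' c')"
    unfolding hausdorff_distance_def by (simp add: le_max_iff_disj)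
qed

lemma orbits_converge_sides:
  assumes tr: "\<And>n. orbit_trace (q n) = sides (A n) (B n) (C n)" "orbit_trace q' = sides a b c"
    and lim: "A \<longlonglongrightarrow> a" "B \<longlonglongrightarrow> b" "C \<longlonglongrightarrow> c"
  shows "orbits_converge q q'"
  unfolding orbits_converge_def tr
proof (rule tendsto_sandwich)
  let ?e = "\<lambda>n. dist (A n) a + dist (B n) b + dist (C n) c"
  have "0 \<le> hausdorff_distance (sides (A n) (B n) (C n)) (sides a b c)"
    "hausdorff_distance (sides (A n) (B n) (C n)) (sides a b c) \<le> ?e n" for n
    by (rule hausdorff_distance_sides[where e = "?e n"]; simp add: add_nonneg_nonneg)+
  then show "\<forall>\<^sub>F n in sequentially. 0 \<le> hausdorff_distance (sides (A n) (B n) (C n)) (sides a b c)"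
    "\<forall>\<^sub>F n in sequentially. hausdorff_distance (sides (A n) (B n) (C n)) (sides a b c) \<le> ?e n"
    by simp_all
  have "?e \<longlonglongrightarrow> dist a a + dist b b + dist c c" by (intro tendsto_intros lim)
  then show "?e \<longlonglongrightarrow> 0" by simp
qed simp

section \<open>Circumscribed polygons\<close>

text \<open>Finitely many boxes inside \<open>U\<close> cover \<open>K\<close>; their corners span the polytope.\<close>

lemma polytope_between_compact_open:
  fixes K U :: "'a::euclidean_space set"
  assumes K: "compact K" and U: "open U" "convex U" and KU: "K \<subseteq> U"
  obtains Q where "polytope Q" "K \<subseteq> Q" "Q \<subseteq> U"
proof -
  have "\<exists>W F. open W \<and> x \<in> W \<and> finite F \<and> W \<subseteq> convex hull F \<and> F \<subseteq> U" if xK: "x \<in> K" for x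
  proof -
    have "x \<in> U" using KU xK by blast
    then obtain a b where ab: "cbox a b \<subseteq> U" "x \<in> box a b"
      using open_contains_cbox[OF U(1)] by metis
    obtain F where "finite F" "cbox a b = convex hull F" using closed_interval_as_convex_hull .
    then have "open (box a b) \<and> x \<in> box a b \<and> finite F \<and> box a b \<subseteq> convex hull F \<and> F \<subseteq> U"
      using ab box_subset_cbox[of a b] hull_subset[of F convex] by (auto simp: open_box)
    then show ?thesis by blast
  qed
  then obtain W F where WF: "\<And>x. x \<in> K \<Longrightarrow> open (W x) \<and> x \<in> W x \<and> finite (F x) \<and>
      W x \<subseteq> convex hull F x \<and> F x \<subseteq> U"
    by metis
  obtain D where D: "D \<subseteq> K" "finite D" "K \<subseteq> (\<Union>x\<in>D. W x)"
    by (rule compactE_image[OF K, of K W]) (use WF in auto)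
  show ?thesis
  proof (rule that)
    show "polytope (convex hull (\<Union>x\<in>D. F x))"
      using D WF by (intro polytope_convex_hull) blast
    show "K \<subseteq> convex hull (\<Union>x\<in>D. F x)"
    proof
      fix k assume "k \<in> K"
      then obtain x where x: "x \<in> D" "k \<in> W x" using D by blast
      then have "k \<in> convex hull F x" using WF D by blast
      moreover have "convex hull F x \<subseteq> convex hull (\<Union>x\<in>D. F x)" using x by (intro hull_mono) blast
      ultimately show "k \<in> convex hull (\<Union>x\<in>D. F x)" by blast
    qed
    show "convex hull (\<Union>x\<in>D. F x) \<subseteq> U"
      using D WF by (intro hull_minimal U(2)) blast
  qed
qed

lemma convex_body_polygon: "convex_polygon P \<Longrightarrow> convex_body P"
  unfolding convex_polygon_def convex_body_def
  by (simp add: polytope_imp_compact polytope_imp_convex)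

lemma subset_interior_scaleR:
  fixes T :: "'a::euclidean_space set"
  assumes "convex T" "0 \<in> interior T" "r > 1"
  shows "T \<subseteq> interior ((*\<^sub>R) r ` T)"
proof
  fix x assume "x \<in> T"
  then have "x - (1 - 1 / r) *\<^sub>R (x - 0) \<in> interior T"
    using assms by (intro mem_interior_convex_shrink) auto
  then have "(1 / r) *\<^sub>R x \<in> interior T" by (simp add: algebra_simps)
  then have "r *\<^sub>R ((1 / r) *\<^sub>R x) \<in> (*\<^sub>R) r ` interior T" by blast
  then show "x \<in> interior ((*\<^sub>R) r ` T)" using assms by (simp add: interior_scaleR)
qed

text \<open>A polygon close to \<open>T\<close> is cut by the three half planes that certify \<open>a, b, c\<close> to be
  untranslatable. The certificate then applies to the polygon too, and no shorter triangle can
  appear, since what is untranslatable in a larger body is untranslatable in \<open>T\<close>.\<close>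

lemma circumscribed_polygon:
  assumes T: "convex_body T" "0 \<in> interior T" and sh: "shortest_triangle T a b c" and r: "r > 1"
  obtains P where "convex_polygon P" "T \<subseteq> P" "P \<subseteq> (*\<^sub>R) r ` T" "shortest_triangle P a b c"
proof -
  have cT: "compact T" "convex T" "interior T \<noteq> {}" using T unfolding convex_body_def by auto
  have abc: "a \<in> T" "b \<in> T" "c \<in> T" and nt: "untranslatable T a b c"
    and min: "\<And>x y z. untranslatable T x y z \<Longrightarrow> perimeter a b c \<le> perimeter x y z"
    using sh unfolding shortest_triangle_def by auto
  obtain u v w where uvw: "u + v + w = 0" "u \<noteq> 0 \<or> v \<noteq> 0 \<or> w \<noteq> 0"
    and sup: "\<forall>x\<in>T. u \<bullet> x \<le> u \<bullet> a" "\<forall>x\<in>T. v \<bullet> x \<le> v \<bullet> b" "\<forall>x\<in>T. w \<bullet> x \<le> w \<bullet> c"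
    by (rule untranslatable_obtain_normals[OF cT(2,3) abc nt])
  obtain Q where Q: "polytope Q" "T \<subseteq> Q" "Q \<subseteq> interior ((*\<^sub>R) r ` T)"
    by (rule polytope_between_compact_open[OF cT(1) open_interior _ subset_interior_scaleR[OF cT(2) T(2) r]])
       (use cT(2) in \<open>auto intro: convex_scaling convex_interior\<close>)
  define P where "P = Q \<inter> ({x. u \<bullet> x \<le> u \<bullet> a} \<inter> {x. v \<bullet> x \<le> v \<bullet> b} \<inter> {x. w \<bullet> x \<le> w \<bullet> c})"
  have TP: "T \<subseteq> P" unfolding P_def using Q(2) sup by blast
  show ?thesis
  proof (rule that)
    have "polytope P"
      unfolding P_def by (intro polytope_Int_polyhedron polyhedron_Int polyhedron_halfspace_le Q(1))
    then show "convex_polygon P"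
      unfolding convex_polygon_def using interior_mono[OF TP] cT(3) by blast
    show "T \<subseteq> P" by (rule TP)
    show "P \<subseteq> (*\<^sub>R) r ` T" unfolding P_def using Q(3) interior_subset by blast
    have "untranslatable P a b c"
      by (rule untranslatable_by_normals[OF uvw, of P "u \<bullet> a" "v \<bullet> b" "w \<bullet> c"]) (auto simp: P_def)
    then show "shortest_triangle P a b c"
      unfolding shortest_triangle_def using abc TP min untranslatable_antimono[OF _ TP] by blast
  qed
qed

lemma shortest_triangle_scaleR:
  assumes sh: "shortest_triangle P a b c" and r: "r > 0"
  shows "shortest_triangle ((*\<^sub>R) r ` P) (r *\<^sub>R a) (r *\<^sub>R b) (r *\<^sub>R c)"
  unfolding shortest_triangle_def
proof (intro conjI allI impI)
  show "r *\<^sub>R a \<in> (*\<^sub>R) r ` P" "r *\<^sub>R b \<in> (*\<^sub>R) r ` P" "r *\<^sub>R c \<in> (*\<^sub>R) r ` P"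
    using sh unfolding shortest_triangle_def by auto
  show "untranslatable ((*\<^sub>R) r ` P) (r *\<^sub>R a) (r *\<^sub>R b) (r *\<^sub>R c)"
    using sh r unfolding shortest_triangle_def by (blast intro: untranslatable_scaleR)
  fix x y z assume "untranslatable ((*\<^sub>R) r ` P) x y z"
  then have "untranslatable P ((1 / r) *\<^sub>R x) ((1 / r) *\<^sub>R y) ((1 / r) *\<^sub>R z)"
    by (rule untranslatable_scaleR) (use r in \<open>auto simp: image_image\<close>)
  then have "perimeter a b c \<le> (1 / r) * perimeter x y z"
    using sh r unfolding shortest_triangle_def by (metis perimeter_scaleR less_imp_le divide_pos_pos zero_less_one)
  then show "perimeter (r *\<^sub>R a) (r *\<^sub>R b) (r *\<^sub>R c) \<le> perimeter x y z"
    using r by (simp add: perimeter_scaleR field_simps)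
qed

section \<open>Approximation of minimal orbits\<close>

lemma min_orbit_length_approximation:
  assumes T: "convex_body T" and app: "polygonal_approximation T \<epsilon> P"
  shows "min_orbit_length P \<le> min_orbit_length T"
    "min_orbit_length T \<le> (1 + \<epsilon>) * min_orbit_length P"
proof -
  have e: "\<epsilon> > 0" and P: "convex_body P" and PT: "P \<subseteq> T" and TP: "T \<subseteq> (*\<^sub>R) (1 + \<epsilon>) ` P"
    using app convex_body_polygon unfolding polygonal_approximation_def by auto
  obtain a b c where abc: "shortest_triangle T a b c" using shortest_triangle_exists[OF T] .
  obtain x y z where xyz: "shortest_triangle P x y z" using shortest_triangle_exists[OF P] .
  note len = min_orbit_length_eq_perimeter[OF T abc] min_orbit_length_eq_perimeter[OF P xyz]
  show "min_orbit_length P \<le> min_orbit_length T"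
    unfolding len using abc xyz untranslatable_antimono[OF _ PT] unfolding shortest_triangle_def by blast
  have "untranslatable T ((1 + \<epsilon>) *\<^sub>R x) ((1 + \<epsilon>) *\<^sub>R y) ((1 + \<epsilon>) *\<^sub>R z)"
    by (rule untranslatable_scaleR[OF _ _ TP]) (use xyz e in \<open>auto simp: shortest_triangle_def\<close>)
  then have "perimeter a b c \<le> perimeter ((1 + \<epsilon>) *\<^sub>R x) ((1 + \<epsilon>) *\<^sub>R y) ((1 + \<epsilon>) *\<^sub>R z)"
    using abc unfolding shortest_triangle_def by blast
  then show "min_orbit_length T \<le> (1 + \<epsilon>) * min_orbit_length P"
    unfolding len using e by (simp add: perimeter_scaleR)
qed

text \<open>The shortest triangles of the polygons subconverge in \<open>T\<close>. Their copies scaled by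
  \<open>1 + \<epsilon> n\<close> are untranslatable with respect to \<open>T\<close> itself, so the limit is untranslatable by
  closedness; it is shortest because each polygon is contained in \<open>T\<close>.\<close>

lemma approximating_orbits_converge:
  assumes T: "convex_body T" and app: "approximating_orbits T \<epsilon> P c"
  shows "\<exists>r q. strict_mono (r :: nat \<Rightarrow> nat) \<and> q \<in> minimal_orbits T \<and> orbits_converge (c \<circ> r) q"
proof -
  have e0: "\<epsilon> \<longlonglongrightarrow> 0" and pa: "\<And>n. polygonal_approximation T (\<epsilon> n) (P n)"
    and cm: "\<And>n. c n \<in> minimal_orbits (P n)"
    using app unfolding approximating_orbits_def by auto
  have e: "\<epsilon> n > 0" and P: "convex_body (P n)" and PT: "P n \<subseteq> T"
    and TP: "T \<subseteq> (*\<^sub>R) (1 + \<epsilon> n) ` P n" for n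
    using pa[of n] convex_body_polygon unfolding polygonal_approximation_def by auto
  have "\<exists>x y z. shortest_triangle (P n) x y z \<and> orbit_trace (c n) = sides x y z" for n
    by (rule minimal_orbit_triangle[OF P cm]) blast
  then obtain X Y Z where sh: "\<And>n. shortest_triangle (P n) (X n) (Y n) (Z n)"
    and tr: "\<And>n. orbit_trace (c n) = sides (X n) (Y n) (Z n)"
    by metis
  have cT: "compact (T \<times> T \<times> T)" using T unfolding convex_body_def by (intro compact_Times) auto
  have "(X n, Y n, Z n) \<in> T \<times> T \<times> T" for n
    using sh PT unfolding shortest_triangle_def by blast
  then have "\<exists>l\<in>T \<times> T \<times> T. \<exists>r. strict_mono r \<and> ((\<lambda>n. (X n, Y n, Z n)) \<circ> r) \<longlonglongrightarrow> l"
    by (intro cT[unfolded compact_def, rule_format])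
  then obtain l and r :: "nat \<Rightarrow> nat" where l: "l \<in> T \<times> T \<times> T" and r: "strict_mono r"
    and lim: "((\<lambda>n. (X n, Y n, Z n)) \<circ> r) \<longlonglongrightarrow> l"
    by blast
  obtain x y z where xyz: "l = (x, y, z)" by (metis prod.exhaust)
  have limX: "(X \<circ> r) \<longlonglongrightarrow> x" and limY: "(Y \<circ> r) \<longlonglongrightarrow> y" and limZ: "(Z \<circ> r) \<longlonglongrightarrow> z"
    using tendsto_fst[OF lim] tendsto_fst[OF tendsto_snd[OF lim]] tendsto_snd[OF tendsto_snd[OF lim]]
    unfolding xyz by (simp_all add: o_def)
  have lime: "(\<lambda>n. 1 + \<epsilon> (r n)) \<longlonglongrightarrow> 1"
    using tendsto_add[OF tendsto_const LIMSEQ_subseq_LIMSEQ[OF e0 r], of 1] by (simp add: o_def)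
  have nt: "untranslatable T x y z"
  proof -
    let ?S = "\<lambda>n. ((1 + \<epsilon> (r n)) *\<^sub>R X (r n), (1 + \<epsilon> (r n)) *\<^sub>R Y (r n), (1 + \<epsilon> (r n)) *\<^sub>R Z (r n))"
    have "?S n \<in> {(a, b, c). untranslatable T a b c}" for n
      using untranslatable_scaleR[OF _ _ TP[of "r n"]] sh[of "r n"] e[of "r n"]
      unfolding shortest_triangle_def by simp
    moreover have "?S \<longlonglongrightarrow> (1 *\<^sub>R x, 1 *\<^sub>R y, 1 *\<^sub>R z)"
      using limX limY limZ lime unfolding o_def by (intro tendsto_Pair tendsto_scaleR)
    ultimately have "(1 *\<^sub>R x, 1 *\<^sub>R y, 1 *\<^sub>R z) \<in> {(a, b, c). untranslatable T a b c}"
      by (rule closed_sequentially[OF closed_untranslatable])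
    then show ?thesis by simp
  qed
  have min: "perimeter x y z \<le> perimeter a b c" if "untranslatable T a b c" for a b c
  proof (rule tendsto_upperbound)
    show "(\<lambda>n. perimeter (X (r n)) (Y (r n)) (Z (r n))) \<longlonglongrightarrow> perimeter x y z"
      unfolding perimeter_def using limX limY limZ unfolding o_def by (intro tendsto_intros)
    have "perimeter (X (r n)) (Y (r n)) (Z (r n)) \<le> perimeter a b c" for n
      using sh[of "r n"] untranslatable_antimono[OF that PT[of "r n"]]
      unfolding shortest_triangle_def by blast
    then show "\<forall>\<^sub>F n in sequentially. perimeter (X (r n)) (Y (r n)) (Z (r n)) \<le> perimeter a b c" by simp
  qed simp
  have sh_lim: "shortest_triangle T x y z"
    unfolding shortest_triangle_def using l nt min unfolding xyz by auto
  obtain q where q: "q \<in> minimal_orbits T" "orbit_trace q = sides x y z"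
    by (rule shortest_triangle_minimal_orbit[OF T sh_lim])
  have "orbits_converge (c \<circ> r) q"
    by (rule orbits_converge_sides[OF _ q(2) limX limY limZ]) (simp add: tr)
  then show ?thesis using r q by blast
qed

text \<open>The orbit is kept up to scaling: polygons circumscribed about \<open>T\<close> with the same shortest
  triangle are shrunk into \<open>T\<close>. The orbit chosen in the polygon is the one provided by that
  triangle, which shares its trace with the scaled copy of \<open>q\<close> but need not have the same
  bounce points.\<close>

lemma minimal_orbit_is_limit:
  assumes T: "convex_body T" "0 \<in> interior T" and q: "q \<in> minimal_orbits T"
  shows "\<exists>\<epsilon> P c. approximating_orbits T \<epsilon> P c \<and> orbits_converge c q"
proof -
  obtain x y z where sh: "shortest_triangle T x y z" and tr: "orbit_trace q = sides x y z"
    using minimal_orbit_triangle[OF T(1) q] .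
  define \<epsilon> where "\<epsilon> n = 1 / real (Suc n)" for n
  have e: "\<epsilon> n > 0" for n unfolding \<epsilon>_def by simp
  have e0: "\<epsilon> \<longlonglongrightarrow> 0" unfolding \<epsilon>_def by (rule LIMSEQ_Suc[OF lim_1_over_n])
  define s where "s n = 1 / (1 + \<epsilon> n)" for n
  have s: "s n > 0" "s n * (1 + \<epsilon> n) = 1" for n
    unfolding s_def using e[of n] by simp_all
  have "\<exists>P. convex_polygon P \<and> T \<subseteq> P \<and> P \<subseteq> (*\<^sub>R) (1 + \<epsilon> n) ` T \<and> shortest_triangle P x y z" for n
    using circumscribed_polygon[OF T sh, of "1 + \<epsilon> n"] e[of n] by (metis less_add_same_cancel1)
  then obtain P' where P': "\<And>n. convex_polygon (P' n)" "\<And>n. T \<subseteq> P' n"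
    "\<And>n. P' n \<subseteq> (*\<^sub>R) (1 + \<epsilon> n) ` T" "\<And>n. shortest_triangle (P' n) x y z"
    by metis
  define P where "P n = (*\<^sub>R) (s n) ` P' n" for n
  have pa: "polygonal_approximation T (\<epsilon> n) (P n)" for n
    unfolding polygonal_approximation_def
  proof (intro conjI)
    show "convex_polygon (P n)"
      using P'(1)[of n] s(1)[of n] polytope_scaling[of "P' n" "s n"]
      unfolding convex_polygon_def P_def by (simp add: interior_scaleR)
    have "P n \<subseteq> (*\<^sub>R) (s n) ` (*\<^sub>R) (1 + \<epsilon> n) ` T" unfolding P_def using P'(3) by (intro image_mono)
    then show "P n \<subseteq> T" by (simp only: image_image scaleR_scaleR s(2)) simp
    have "(*\<^sub>R) (1 + \<epsilon> n) ` P n = P' n"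
      unfolding P_def by (simp only: image_image scaleR_scaleR mult.commute[of _ "s n"] s(2)) simp
    then show "T \<subseteq> (*\<^sub>R) (1 + \<epsilon> n) ` P n" using P'(2) by simp
  qed (rule e)
  have shP: "shortest_triangle (P n) (s n *\<^sub>R x) (s n *\<^sub>R y) (s n *\<^sub>R z)" for n
    unfolding P_def by (rule shortest_triangle_scaleR[OF P'(4) s(1)])
  have bodyP: "convex_body (P n)" for n
    using pa[of n] convex_body_polygon unfolding polygonal_approximation_def by blast
  have "\<exists>c. c \<in> minimal_orbits (P n) \<and>
      orbit_trace c = sides (s n *\<^sub>R x) (s n *\<^sub>R y) (s n *\<^sub>R z)" for n
    by (rule shortest_triangle_minimal_orbit[OF bodyP shP]) blast
  then obtain c where c: "\<And>n. c n \<in> minimal_orbits (P n)"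
    "\<And>n. orbit_trace (c n) = sides (s n *\<^sub>R x) (s n *\<^sub>R y) (s n *\<^sub>R z)" by metis
  have "s \<longlonglongrightarrow> 1 / (1 + 0)"
    unfolding s_def by (intro tendsto_divide tendsto_add tendsto_const e0) simp
  then have lim: "(\<lambda>n. s n *\<^sub>R p) \<longlonglongrightarrow> p" for p :: plane
    using tendsto_scaleR[OF _ tendsto_const, of s 1 sequentially p] by simp
  have "orbits_converge c q" by (rule orbits_converge_sides[OF c(2) tr lim lim lim])
  moreover have "approximating_orbits T \<epsilon> P c"
    unfolding approximating_orbits_def using e0 pa c(1) by blast
  ultimately show ?thesis by blast
qed

theorem mainTheorem5:
  fixes T :: "(real ^ 2) set"
  assumes "compact T" and "convex T" and "0 \<in> interior T"
  shows "(\<forall>\<epsilon> P. polygonal_approximation T \<epsilon> P \<longrightarrow>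
            min_orbit_length P \<le> min_orbit_length T \<and>
            min_orbit_length T \<le> (1 + \<epsilon>) * min_orbit_length P) \<and>
         (\<forall>\<epsilon> P c. approximating_orbits T \<epsilon> P c \<longrightarrow>
            (\<exists>r q. strict_mono (r :: nat \<Rightarrow> nat) \<and> q \<in> minimal_orbits T \<and>
               orbits_converge (c \<circ> r) q)) \<and>
         (\<forall>q \<in> minimal_orbits T. \<exists>\<epsilon> P c. approximating_orbits T \<epsilon> P c \<and> orbits_converge c q)"
proof -
  have T: "convex_body T" using assms unfolding convex_body_def by auto
  show ?thesis
    using min_orbit_length_approximation[OF T] approximating_orbits_converge[OF T]
      minimal_orbit_is_limit[OF T assms(3)] by blast
qed

end
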